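(* Let the channel be in any one of the three cases described in the context, and let $\kappa\geq 0$ vary with all other parameters fixed. When $\kappa$ increases: (1) $\mathcal{E}^\star$ strictly increases. (2) If $\phi$ is strictly convex on $[0,\infty)$, then $s^\star$ strictly decreases; moreover, $\lim_{\kappa\to+\infty}s^\star=0$ and $\lim_{\kappa\to0}s^\star=s_1$, where $s_1$ satisfies $\frac{\sigma^2}{\xi}f(s_1)=P_c$. (3) If $\phi(R)=R$, then $s^\star$ is fixed and equal to $s_1$ (the value satisfying $\frac{\sigma^2}{\xi}f(s_1)=P_c$) for every $\kappa$.
   Context: Constants: bandwidth $B>0$, noise variance $\sigma^2>0$, power-amplifier efficiency $\xi>0$, rate-independent circuit power $P_c>0$, coefficient $\kappa\ge 0$. The function $\phi:[0,\infty)\to\mathbb{R}$ satisfies $\phi(0)=0$ and is differentiable, strictly increasing and (not necessarily strictly) convex on $[0,\infty)$. The function $\rho(s)$, $s\ge 0$ (minimum transmission power needed to achieve spectral efficiency $s$, divided by $\sigma^2$) is defined in three cases. Case 1 (static channel, transmitter knows the channel): $G>0$ is a constant and $\rho(s)=\min\{p\ge0:\log_2(1+Gp)\ge s\}=\frac1G(2^s-1)$. Case 2 (fast-varying channel, transmitter knows its distribution): $G\ge0$ is a random variable with a probability density function and $\rho(s)=\min\{p\ge 0:\mathbb{E}_G[\log_2(1+Gp)]\ge s\}$. Case 3 (fast-varying channel, transmitter knows the channel): $G$ is a random variable as in Case 2 and $\rho(s)=\min \mathbb{E}_G[p(G)]$ over all nonnegative (measurable) functions $p(\cdot)$ on $[0,\infty)$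 satisfying $\mathbb{E}_G[\log_2(1+Gp(G))]\ge s$. In Cases 2 and 3, $\mathbb{E}_G[\log_2(1+Gp)]<\infty$ for every constant $p\ge0$. Minimum total power: $P(s)=\kappa\phi(Bs)+\frac{\sigma^2}{\xi}\rho(s)+P_c$. Energy per bit (the energy efficiency; smaller is better): $\mathcal{E}(s)=\frac{P(s)}{Bs}$ for $s>0$, with $\mathcal{E}(0)=+\infty$. The optimum value is $\mathcal{E}^\star=\min_{s\ge0}\mathcal{E}(s)$ and $s^\star$ is the (unique) minimizer; both are regarded as functions of the parameters. Finally $f(s)=s\rho'(s)-\rho(s)$, where a prime denotes the derivative. *)

theory Defs
  imports "HOL-Probability.Probability"
begin

text \<open>
  A static channel is given by its constant gain, a fast-varying one by a probability space
  and the random gain on it. In the second case the transmitter knows the distribution of the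
  gain only, in the third it knows the gain itself.
\<close>

datatype 'a channel =
    Static real
  | Fast_Unknown "'a measure" "'a \<Rightarrow> real"
  | Fast_Known "'a measure" "'a \<Rightarrow> real"

definition fading_gain :: "'a measure \<Rightarrow> ('a \<Rightarrow> real) \<Rightarrow> bool" where
  "fading_gain M G \<longleftrightarrow>
     prob_space M \<and>
     (\<forall>\<omega>\<in>space M. 0 \<le> G \<omega>) \<and>
     (\<exists>h. distributed M lborel G h) \<and>
     (\<forall>p\<ge>0. integrable M (\<lambda>\<omega>. log 2 (1 + G \<omega> * p)))"

fun valid_channel :: "'a channel \<Rightarrow> bool" where
  "valid_channel (Static g) \<longleftrightarrow> 0 < g"
| "valid_channel (Fast_Unknown M G) \<longleftrightarrow> fading_gain M G"
| "valid_channel (Fast_Known M G) \<longleftrightarrow> fading_gain M G"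

text \<open>
  Every minimum over a set is rendered by \<open>LEAST\<close>, which denotes the minimum exactly when it is
  attained. In the third case expectations are nonnegative Lebesgue integrals, so that policies
  of infinite mean power are admitted with their true value.
\<close>

fun min_power :: "'a channel \<Rightarrow> real \<Rightarrow> real" where
  "min_power (Static g) s = (LEAST p. 0 \<le> p \<and> s \<le> log 2 (1 + g * p))"
| "min_power (Fast_Unknown M G) s =
     (LEAST p. 0 \<le> p \<and> s \<le> (\<integral>\<omega>. log 2 (1 + G \<omega> * p) \<partial>M))"
| "min_power (Fast_Known M G) s =
     enn2real (LEAST e. \<exists>p \<in> borel_measurable (restrict_space borel {0..}).
        (\<forall>g\<ge>0. 0 \<le> p g) \<and>
        ennreal s \<le> (\<integral>\<^sup>+\<omega>. ennreal (log 2 (1 + G \<omega> * p (G \<omega>))) \<partial>M) \<and>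
        e = (\<integral>\<^sup>+\<omega>. ennreal (p (G \<omega>)) \<partial>M))"

definition total_power ::
  "real \<Rightarrow> real \<Rightarrow> real \<Rightarrow> real \<Rightarrow> (real \<Rightarrow> real) \<Rightarrow> 'a channel \<Rightarrow> real \<Rightarrow> real \<Rightarrow> real" where
  "total_power B \<sigma> \<xi> P\<^sub>c \<phi> C \<kappa> s = \<kappa> * \<phi> (B * s) + \<sigma>\<^sup>2 / \<xi> * min_power C s + P\<^sub>c"

definition energy_per_bit ::
  "real \<Rightarrow> real \<Rightarrow> real \<Rightarrow> real \<Rightarrow> (real \<Rightarrow> real) \<Rightarrow> 'a channel \<Rightarrow> real \<Rightarrow> real \<Rightarrow> ereal" where
  "energy_per_bit B \<sigma> \<xi> P\<^sub>c \<phi> C \<kappa> s =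
     (if s = 0 then \<infinity> else ereal (total_power B \<sigma> \<xi> P\<^sub>c \<phi> C \<kappa> s / (B * s)))"

definition opt_energy ::
  "real \<Rightarrow> real \<Rightarrow> real \<Rightarrow> real \<Rightarrow> (real \<Rightarrow> real) \<Rightarrow> 'a channel \<Rightarrow> real \<Rightarrow> ereal" where
  "opt_energy B \<sigma> \<xi> P\<^sub>c \<phi> C \<kappa> = (LEAST e. e \<in> energy_per_bit B \<sigma> \<xi> P\<^sub>c \<phi> C \<kappa> ` {0..})"

definition opt_rate ::
  "real \<Rightarrow> real \<Rightarrow> real \<Rightarrow> real \<Rightarrow> (real \<Rightarrow> real) \<Rightarrow> 'a channel \<Rightarrow> real \<Rightarrow> real" where
  "opt_rate B \<sigma> \<xi> P\<^sub>c \<phi> C \<kappa> =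
     (THE s. is_arg_min (energy_per_bit B \<sigma> \<xi> P\<^sub>c \<phi> C \<kappa>) (\<lambda>s. 0 \<le> s) s)"

text \<open>
  At \<open>s = 0\<close> the factor \<open>s\<close> makes the value independent of the two-sided derivative,
  which need not exist there.
\<close>

definition marginal_gap :: "'a channel \<Rightarrow> real \<Rightarrow> real" where
  "marginal_gap C s = s * deriv (min_power C) s - min_power C s"

definition strictly_convex_on :: "real set \<Rightarrow> (real \<Rightarrow> real) \<Rightarrow> bool" where
  "strictly_convex_on S f \<longleftrightarrow>
     convex S \<and>
     (\<forall>x\<in>S. \<forall>y\<in>S. \<forall>t. x \<noteq> y \<and> 0 < t \<and> t < 1 \<longrightarrow>
        f ((1 - t) * x + t * y) < (1 - t) * f x + t * f y)"

end

theory Submission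
  imports Defs
begin

text \<open>
  Write \<open>gap \<psi> e x = x * e x - \<psi> x\<close>, where \<open>e\<close> is the derivative of a convex \<open>\<psi>\<close>. A rate
  \<open>s > 0\<close> minimises \<open>(\<psi> s + c) / s\<close> as soon as \<open>gap \<psi> e s = c\<close>, by the tangent inequality, and the
  gap is monotone in the rate. For the variable power \<open>\<kappa> * \<phi> (B * s) + \<sigma>\<^sup>2 / \<xi> * \<rho> s\<close> the gap is the
  same combination of the gaps of \<open>\<phi> (B * s)\<close> and \<open>\<rho>\<close>; the first is positive if \<open>\<phi>\<close> is strictly
  convex and vanishes if \<open>\<phi>\<close> is linear, which gives all the monotonicity and limit claims.

  A static channel is a fading channel over a one-point probability space. It remains to see that
  \<open>\<rho>\<close> is smooth and strictly convex with unbounded slope. When only the distribution of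
  the gain is known, \<open>\<rho>\<close> is the inverse of the mean rate at constant power. When the gain itself
  is known, the tangent inequality is weak duality for the power allocation problem, with equality
  for water-filling.
\<close>

section \<open>Convex functions and their slopes\<close>

text \<open>Convexity is encoded by supporting lines at positive points. This gives the inequalities
  directly and avoids a derivative at 0, and continuity of \<open>e\<close> makes it the true
  derivative on the open half-line.\<close>

definition smooth_convex :: "(real \<Rightarrow> real) \<Rightarrow> (real \<Rightarrow> real) \<Rightarrow> bool" where
  "smooth_convex \<psi> e \<longleftrightarrow> \<psi> 0 = 0 \<and> (\<forall>x\<ge>0. 0 \<le> \<psi> x) \<and> continuous_on {0<..} e \<and>
     (\<forall>x>0. \<forall>y\<ge>0. \<psi> x + e x * (y - x) \<le> \<psi> y)"

text \<open>The tangent at \<open>x\<close> meets the vertical axis at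
  \<open>- gap \<psi> e x\<close>; equivalently, this is the value of the convex conjugate at the
  slope \<open>e x\<close>.\<close>

definition gap :: "(real \<Rightarrow> real) \<Rightarrow> (real \<Rightarrow> real) \<Rightarrow> real \<Rightarrow> real" where
  "gap \<psi> e x = x * e x - \<psi> x"

lemma smooth_convex_tangent:
  "smooth_convex \<psi> e \<Longrightarrow> 0 < x \<Longrightarrow> 0 \<le> y \<Longrightarrow> \<psi> x + e x * (y - x) \<le> \<psi> y"
  by (simp add: smooth_convex_def)

lemma smooth_convex_zero: "smooth_convex \<psi> e \<Longrightarrow> \<psi> 0 = 0"
  by (simp add: smooth_convex_def)

lemma smooth_convex_nonneg: "smooth_convex \<psi> e \<Longrightarrow> 0 \<le> x \<Longrightarrow> 0 \<le> \<psi> x"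
  by (simp add: smooth_convex_def)

text \<open>Add the tangent inequalities at \<open>x\<close> and at \<open>y\<close>. Continuity of
  \<open>e\<close> is not assumed, because the proof that slopes are continuous relies on
  this.\<close>

lemma tangent_slopes_mono:
  fixes \<psi> e :: "real \<Rightarrow> real"
  assumes "\<And>x y. 0 < x \<Longrightarrow> 0 \<le> y \<Longrightarrow> \<psi> x + e x * (y - x) \<le> \<psi> y" "0 < x" "x \<le> y"
  shows "e x \<le> e y"
proof (cases "x = y")
  case False
  have "\<psi> x + e x * (y - x) \<le> \<psi> y" "\<psi> y + e y * (x - y) \<le> \<psi> x"
    using assms by auto
  then have "(y - x) * e x \<le> (y - x) * e y"
    by (simp add: algebra_simps)
  with False \<open>x \<le> y\<close> show ?thesis
    by (simp add: mult_le_cancel_left)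
qed simp

lemma smooth_convex_slope_mono:
  assumes "smooth_convex \<psi> e" "0 < x" "x \<le> y"
  shows "e x \<le> e y"
  using assms tangent_slopes_mono[of \<psi> e] smooth_convex_tangent[of \<psi> e] by blast

lemma gap_nonneg: "smooth_convex \<psi> e \<Longrightarrow> 0 < x \<Longrightarrow> 0 \<le> gap \<psi> e x"
  using smooth_convex_tangent[of \<psi> e x 0] smooth_convex_zero[of \<psi> e]
  by (simp add: gap_def mult.commute)

text \<open>The tangent at \<open>y\<close>, evaluated at \<open>x\<close>, shows that the gap grows
  by at least \<open>x * (e y - e x)\<close>.\<close>

lemma gap_strict_mono:
  assumes "smooth_convex \<psi> e" "strict_mono_on {0<..} e" "0 < x" "x < y"
  shows "gap \<psi> e x < gap \<psi> e y"
proof -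
  have "\<psi> y + e y * (x - y) \<le> \<psi> x"
    using assms by (intro smooth_convex_tangent) auto
  moreover have "x * e x < x * e y"
    using strict_mono_onD[OF assms(2), of x y] assms by simp
  ultimately show ?thesis
    by (simp add: gap_def algebra_simps)
qed

text \<open>The difference quotient lies between the slopes at its two ends, and these merge by
  continuity of \<open>e\<close>.\<close>

lemma smooth_convex_derivative:
  assumes "smooth_convex \<psi> e" "0 < x"
  shows "(\<psi> has_real_derivative e x) (at x)"
  unfolding has_field_derivative_iff
proof (rule metric_tendsto_imp_tendsto)
  have "isCont e x"
    using assms by (auto simp: smooth_convex_def continuous_on_eq_continuous_at)
  then show "(e \<longlongrightarrow> e x) (at x)"
    by (simp add: isCont_def)
  have "dist ((\<psi> y - \<psi> x) / (y - x)) (e x) \<le> dist (e y) (e x)" if "0 < y" "y \<noteq> x" for y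
  proof -
    have *: "e x * (y - x) \<le> \<psi> y - \<psi> x" "\<psi> y - \<psi> x \<le> e y * (y - x)"
      using smooth_convex_tangent[OF assms(1), of x y] smooth_convex_tangent[OF assms(1), of y x]
        assms(2) that by (auto simp: algebra_simps)
    show ?thesis
    proof (cases "x < y")
      case True
      then have "e x \<le> (\<psi> y - \<psi> x) / (y - x)" "(\<psi> y - \<psi> x) / (y - x) \<le> e y"
        using * by (simp_all add: pos_le_divide_eq pos_divide_le_eq)
      then show ?thesis by (simp add: dist_real_def)
    next
      case False
      then have "e y \<le> (\<psi> y - \<psi> x) / (y - x)" "(\<psi> y - \<psi> x) / (y - x) \<le> e x"
        using * that by (simp_all add: neg_le_divide_eq neg_divide_le_eq)
      then show ?thesis by (simp add: dist_real_def)
    qed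
  qed
  moreover have "\<forall>\<^sub>F y in at x. 0 < y"
    using assms(2) order_tendstoD(1)[OF tendsto_ident_at] by blast
  ultimately show "\<forall>\<^sub>F y in at x. dist ((\<psi> y - \<psi> x) / (y - x)) (e x) \<le> dist (e y) (e x)"
    unfolding eventually_at_filter by (auto elim!: eventually_mono)
qed

text \<open>A differentiable convex function has a continuous derivative: \<open>e y\<close> lies
  between \<open>e x\<close> and the difference quotient from \<open>y\<close> to the reflected
  point \<open>2 * y - x\<close>, which also tends to \<open>e x\<close>.\<close>

lemma continuous_on_tangent_slopes:
  fixes \<psi> e :: "real \<Rightarrow> real"
  assumes tan: "\<And>x y. 0 < x \<Longrightarrow> 0 \<le> y \<Longrightarrow> \<psi> x + e x * (y - x) \<le> \<psi> y"
    and der: "\<And>x. 0 < x \<Longrightarrow> (\<psi> has_real_derivative e x) (at x)"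
  shows "continuous_on {0<..} e"
proof -
  have "isCont e x" if x: "0 < x" for x
    unfolding isCont_def
  proof (rule metric_tendsto_imp_tendsto)
    define D where "D = (\<lambda>y. (\<psi> y - \<psi> x) / (y - x))"
    have D: "(D \<longlongrightarrow> e x) (at x)"
      using der[OF x] by (simp add: D_def has_field_derivative_iff)
    have "((\<lambda>y. 2 * y - x) \<longlongrightarrow> 2 * x - x) (at x)"
      by (intro tendsto_intros)
    then have "filterlim (\<lambda>y. 2 * y - x) (at x) (at x)"
      by (auto simp: filterlim_at eventually_at_filter)
    then have "((\<lambda>y. D (2 * y - x)) \<longlongrightarrow> e x) (at x)"
      using D by (rule filterlim_compose[rotated])
    \<comment> \<open>This combination of quotients based at \<open>x\<close> equals the quotient
      from \<open>y\<close> to \<open>2 * y - x\<close>.\<close>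
    then have "((\<lambda>y. 2 * D (2 * y - x) - D y) \<longlongrightarrow> 2 * e x - e x) (at x)"
      by (intro tendsto_intros D)
    then show "((\<lambda>y. 2 * D (2 * y - x) - D y) \<longlongrightarrow> e x) (at x)"
      by simp
    \<comment> \<open>The bound \<open>x / 2 < y\<close> keeps the reflected point in the domain of
      the tangent inequality.\<close>
    have "dist (e y) (e x) \<le> dist (2 * D (2 * y - x) - D y) (e x)" if "x / 2 < y" "y \<noteq> x" for y
    proof -
      have y: "0 < y" "0 \<le> 2 * y - x"
        using that x by auto
      have "2 * D (2 * y - x) = (\<psi> (2 * y - x) - \<psi> x) / (y - x)"
        using mult_divide_mult_cancel_left[of 2 "\<psi> (2 * y - x) - \<psi> x" "y - x"]
        by (simp add: D_def algebra_simps)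
      then have eq: "2 * D (2 * y - x) - D y = (\<psi> (2 * y - x) - \<psi> y) / (y - x)"
        by (simp add: D_def diff_divide_distrib)
      have *: "e y * (y - x) \<le> \<psi> (2 * y - x) - \<psi> y"
        using tan[OF y] by (simp add: algebra_simps)
      show ?thesis
      proof (cases "x < y")
        case True
        have "e x \<le> e y"
          using tangent_slopes_mono[OF tan, of x y] x True by auto
        moreover have "e y \<le> 2 * D (2 * y - x) - D y"
          unfolding eq using * True by (simp add: pos_le_divide_eq)
        ultimately show ?thesis by (simp add: dist_real_def)
      next
        case False
        have "e y \<le> e x"
          using tangent_slopes_mono[OF tan, of y x] y False by auto
        moreover have "2 * D (2 * y - x) - D y \<le> e y"
          unfolding eq using * False that by (simp add: neg_divide_le_eq)
        ultimately show ?thesis by (simp add: dist_real_def)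
      qed
    qed
    moreover have "\<forall>\<^sub>F y in at x. x / 2 < y"
      using x order_tendstoD(1)[OF tendsto_ident_at, of "x / 2" x] by simp
    ultimately show "\<forall>\<^sub>F y in at x. dist (e y) (e x) \<le> dist (2 * D (2 * y - x) - D y) (e x)"
      unfolding eventually_at_filter by (auto elim!: eventually_mono)
  qed
  then show ?thesis
    by (intro continuous_at_imp_continuous_on) auto
qed

lemma convex_differentiable_imp_smooth_convex:
  assumes "\<psi> 0 = 0" "\<And>x. 0 \<le> x \<Longrightarrow> 0 \<le> \<psi> x"
    and conv: "convex_on {0..} \<psi>" and diff: "\<psi> differentiable_on {0..}"
  obtains e where "smooth_convex \<psi> e"
proof -
  have "\<exists>e. (\<psi> has_real_derivative e) (at x)" if "0 < x" for x
  proof -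
    \<comment> \<open>Passing to the open half-line turns the derivative within \<open>{0..}\<close>
      into a two-sided one.\<close>
    have "\<psi> differentiable (at x within {0<..})"
      by (rule differentiable_within_subset[of \<psi> x "{0..}"])
        (use diff that in \<open>auto simp: differentiable_on_def\<close>)
    then have "\<psi> differentiable (at x)"
      using at_within_open[of x "{0<..}"] that by simp
    then show ?thesis
      by (rule real_differentiableE) blast
  qed
  then obtain e where e: "\<And>x. 0 < x \<Longrightarrow> (\<psi> has_real_derivative e x) (at x)"
    by metis
  have tan: "\<psi> x + e x * (y - x) \<le> \<psi> y" if "0 < x" "0 \<le> y" for x y
    using convex_on_imp_above_tangent[OF conv, of x y "e x"] e[OF that(1)] that
    by (auto simp: has_field_derivative_at_within)
  have "smooth_convex \<psi> e"
    using assms(1,2) tan continuous_on_tangent_slopes[OF tan e] by (auto simp: smooth_convex_def)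
  then show thesis ..
qed

section \<open>Rescaling and nonnegative combinations\<close>

lemma smooth_convex_scale:
  assumes "smooth_convex \<psi> e" "0 < B"
  shows "smooth_convex (\<lambda>s. \<psi> (B * s)) (\<lambda>s. B * e (B * s))"
  unfolding smooth_convex_def
proof (intro conjI allI impI)
  have "continuous_on {0<..} (\<lambda>s. e (B * s))"
    using assms by (intro continuous_on_compose2[of "{0<..}" e "{0<..}" "\<lambda>s. B * s"])
      (auto simp: smooth_convex_def intro!: continuous_intros)
  then show "continuous_on {0<..} (\<lambda>s. B * e (B * s))"
    by (rule continuous_on_mult_left)
  fix x y :: real assume "0 < x" "0 \<le> y"
  then show "\<psi> (B * x) + B * e (B * x) * (y - x) \<le> \<psi> (B * y)"
    using smooth_convex_tangent[OF assms(1), of "B * x" "B * y"] assms(2)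
    by (simp add: algebra_simps)
qed (use assms in \<open>auto simp: smooth_convex_def\<close>)

lemma smooth_convex_combine:
  assumes "smooth_convex \<psi> e" "smooth_convex \<rho> d" "0 \<le> a" "0 \<le> b"
  shows "smooth_convex (\<lambda>s. a * \<psi> s + b * \<rho> s) (\<lambda>s. a * e s + b * d s)"
  unfolding smooth_convex_def
proof (intro conjI allI impI)
  show "continuous_on {0<..} (\<lambda>s. a * e s + b * d s)"
    using assms by (auto simp: smooth_convex_def intro!: continuous_intros)
  fix x y :: real assume "0 < x" "0 \<le> y"
  then have "a * (\<psi> x + e x * (y - x)) \<le> a * \<psi> y" "b * (\<rho> x + d x * (y - x)) \<le> b * \<rho> y"
    using assms by (auto intro!: mult_left_mono smooth_convex_tangent)
  then show "a * \<psi> x + b * \<rho> x + (a * e x + b * d x) * (y - x) \<le> a * \<psi> y + b * \<rho> y"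
    by (simp add: algebra_simps)
qed (use assms in \<open>auto simp: smooth_convex_def\<close>)

lemma gap_combine:
  "gap (\<lambda>s. a * \<psi> s + b * \<rho> s) (\<lambda>s. a * e s + b * d s) x = a * gap \<psi> e x + b * gap \<rho> d x"
  by (simp add: gap_def algebra_simps)

section \<open>Solving the gap equation and minimising the ratio\<close>

lemma gap_attains:
  assumes sc: "smooth_convex \<psi> e" and "0 < x" "0 < c" "c \<le> gap \<psi> e x"
  obtains y where "0 < y" "gap \<psi> e y = c"
proof -
  have "0 \<le> x * e x"
    using gap_nonneg[OF sc \<open>0 < x\<close>] smooth_convex_nonneg[OF sc, of x] \<open>0 < x\<close>
    by (simp add: gap_def)
  then have e0: "0 \<le> e x"
    using \<open>0 < x\<close> by (simp add: zero_le_mult_iff)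
  \<comment> \<open>Near 0 the gap is small, since \<open>gap \<psi> e z \<le> z * e x\<close>. The
    summand 1 keeps the denominator positive when \<open>e x = 0\<close>, and the intermediate value
    theorem applies between \<open>z\<close> and \<open>x\<close>.\<close>
  define z where "z = min x (c / (1 + e x))"
  have z: "0 < z" "z \<le> x" "z \<le> c / (1 + e x)"
    using assms e0 by (auto simp: z_def)
  have "gap \<psi> e z \<le> z * e z"
    using smooth_convex_nonneg[OF sc, of z] z by (simp add: gap_def)
  also have "\<dots> \<le> z * e x"
    using z smooth_convex_slope_mono[OF sc, of z x] by (intro mult_left_mono) auto
  also have "\<dots> \<le> z * (1 + e x)"
    using z by (intro mult_left_mono) auto
  also have "\<dots> \<le> c"
    using z e0 by (simp add: pos_le_divide_eq)
  finally have "gap \<psi> e z \<le> c" .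
  moreover have "continuous_on {z..x} (gap \<psi> e)"
  proof -
    have "continuous_on {z..x} e"
      using sc z by (auto simp: smooth_convex_def intro: continuous_on_subset)
    moreover have "continuous_on {z..x} \<psi>"
      using z DERIV_isCont[OF smooth_convex_derivative[OF sc]]
      by (intro continuous_at_imp_continuous_on) auto
    ultimately show ?thesis
      unfolding gap_def by (intro continuous_intros)
  qed
  ultimately obtain y where "z \<le> y" "gap \<psi> e y = c"
    using IVT'[of "gap \<psi> e" z c x] assms z by auto
  then show thesis
    using z that[of y] by simp
qed

text \<open>Follow the tangent at \<open>x\<close> to the midpoint of \<open>x\<close> and
  \<open>y\<close>, then the tangent there: its slope differs strictly from \<open>e x\<close>, in
  the favourable direction on either side.\<close>

lemma strict_tangent:
  assumes sc: "smooth_convex \<psi> e" "strict_mono_on {0<..} e" and "0 < x" "0 \<le> y" "y \<noteq> x"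
  shows "\<psi> x + e x * (y - x) < \<psi> y"
proof -
  define z where "z = (x + y) / 2"
  have z: "0 < z" "y - z = (y - x) / 2" "z - x = (y - x) / 2"
    using assms by (auto simp: z_def field_simps)
  have "\<psi> z + e z * (y - z) \<le> \<psi> y" "\<psi> x + e x * (z - x) \<le> \<psi> z"
    using assms z by (auto intro!: smooth_convex_tangent[OF sc(1)])
  moreover have "e x * (y - x) < e z * (y - x)"
  proof (cases "x < y")
    case True
    then have "e x < e z"
      using z assms by (intro strict_mono_onD[OF sc(2)]) auto
    with True show ?thesis by simp
  next
    case False
    then have "e z < e x"
      using z assms by (intro strict_mono_onD[OF sc(2)]) auto
    with False \<open>y \<noteq> x\<close> show ?thesis by simp
  qed
  ultimately show ?thesis
    unfolding z by simp
qed

text \<open>If the gap equals \<open>c\<close>, the tangent to \<open>\<psi> + c\<close> at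
  \<open>x\<close> passes through the origin. Its slope \<open>e x\<close> is then the ratio at
  \<open>x\<close>, and the graph lies strictly above this line elsewhere.\<close>

lemma gap_imp_strict_ratio_min:
  assumes sc: "smooth_convex \<psi> e" "strict_mono_on {0<..} e"
    and x: "0 < x" "gap \<psi> e x = c" and y: "0 < y" "y \<noteq> x"
  shows "(\<psi> x + c) / x < (\<psi> y + c) / y"
proof -
  have "\<psi> x + e x * (y - x) < \<psi> y"
    using strict_tangent[OF sc] x y by auto
  then have "e x * y < \<psi> y + c"
    using x(2) by (simp add: gap_def algebra_simps)
  then have "e x < (\<psi> y + c) / y"
    using y by (simp add: pos_less_divide_eq)
  moreover have "(\<psi> x + c) / x = e x"
    using x by (auto simp: gap_def field_simps)
  ultimately show ?thesis by simp
qed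

text \<open>
  The parameter \<open>t\<close> will be the transmission power or the water level; continuity of the
  slopes comes for free because the inverse of \<open>w\<close> is monotone with open image.
\<close>

lemma smooth_convex_parametric:
  fixes w c \<rho> :: "real \<Rightarrow> real"
  assumes "\<rho> 0 = 0" "\<And>x. 0 \<le> x \<Longrightarrow> 0 \<le> \<rho> x"
    and T: "open T" and w: "strict_mono_on T w" "w ` T = {0<..}"
    and c: "strict_mono_on T c" "continuous_on T c" "\<And>K. \<exists>t\<in>T. K \<le> c t"
    and tan: "\<And>t y. t \<in> T \<Longrightarrow> 0 \<le> y \<Longrightarrow> \<rho> (w t) + c t * (y - w t) \<le> \<rho> y"
  obtains d where "smooth_convex \<rho> d" "strict_mono_on {0<..} d" "\<And>K. \<exists>x>0. K \<le> d x"
proof -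
  define v where "v = the_inv_into T w"
  have inj: "inj_on w T"
    using w(1) by (rule strict_mono_on_imp_inj_on)
  have v: "v x \<in> T" "w (v x) = x" if "0 < x" for x
    using that w(2) inj
    by (auto simp: v_def intro!: the_inv_into_into f_the_inv_into_f)
  have vw: "v (w t) = t" if "t \<in> T" for t
    using inj that by (simp add: v_def the_inv_into_f_f)
  have mono: "v x < v y" if "0 < x" "x < y" for x y
  proof (rule ccontr)
    assume "\<not> v x < v y"
    then have "w (v y) \<le> w (v x)"
      using v[of x] v[of y] that by (intro strict_mono_on_leD[OF w(1)]) auto
    then show False
      using v[of x] v[of y] that by simp
  qed
  have img: "v ` {0<..} = T"
  proof
    show "v ` {0<..} \<subseteq> T"
      using v by auto
    show "T \<subseteq> v ` {0<..}"
    proof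
      fix t assume "t \<in> T"
      then have "w t \<in> {0<..}" "t = v (w t)"
        using w(2) vw by auto
      then show "t \<in> v ` {0<..}" by blast
    qed
  qed
  have "continuous_on {0<..} v"
  proof (rule continuous_onI_mono)
    show "open (v ` {0<..})"
      using T by (simp add: img)
    show "v x \<le> v y" if "x \<in> {0<..}" "y \<in> {0<..}" "x \<le> y" for x y
      using mono[of x y] that by (cases "x = y") auto
  qed
  then have "continuous_on {0<..} (\<lambda>x. c (v x))"
    using v by (intro continuous_on_compose2[OF c(2)]) auto
  then have "smooth_convex \<rho> (\<lambda>x. c (v x))"
    using assms(1,2) tan[OF v(1)] v(2) by (simp add: smooth_convex_def)
  moreover have "strict_mono_on {0<..} (\<lambda>x. c (v x))"
    using mono v by (auto simp: strict_mono_on_def intro!: strict_mono_onD[OF c(1)])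
  moreover have "\<exists>x>0. K \<le> c (v x)" for K
  proof -
    obtain t where "t \<in> T" "K \<le> c t"
      using c(3) by blast
    moreover from this have "0 < w t"
      using w(2) by auto
    ultimately show ?thesis
      using vw by (intro exI[of _ "w t"]) simp
  qed
  ultimately show thesis ..
qed

text \<open>Monotonicity and growth make \<open>w\<close> 1-Lipschitz with respect to
  \<open>log 2\<close>, hence continuous; the rest is the intermediate value theorem.\<close>

lemma log_growth_onto:
  fixes w :: "real \<Rightarrow> real"
  assumes mono: "\<And>p q. 0 < p \<Longrightarrow> p \<le> q \<Longrightarrow> w p \<le> w q"
    and growth: "\<And>p q. 0 < p \<Longrightarrow> p \<le> q \<Longrightarrow> w q \<le> w p + log 2 (q / p)"
    and small: "\<And>\<epsilon>. 0 < \<epsilon> \<Longrightarrow> \<exists>p>0. w p < \<epsilon>"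
    and large: "\<And>K. \<exists>p>0. K \<le> w p"
  shows "continuous_on {0<..} w" "{0<..} \<subseteq> w ` {0<..}"
proof -
  show cont: "continuous_on {0<..} w"
    unfolding continuous_on_def
  proof
    fix p :: real assume p: "p \<in> {0<..}"
    show "(w \<longlongrightarrow> w p) (at p within {0<..})"
    proof (rule metric_tendsto_imp_tendsto)
      show "(log 2 \<longlongrightarrow> log 2 p) (at p within {0<..})"
        using p by (intro tendsto_intros) auto
      have "dist (w q) (w p) \<le> dist (log 2 q) (log 2 p)" if "0 < q" for q
        using p that mono[of p q] mono[of q p] growth[of p q] growth[of q p]
        by (cases "p \<le> q") (auto simp: dist_real_def log_divide)
      then show "\<forall>\<^sub>F q in at p within {0<..}. dist (w q) (w p) \<le> dist (log 2 q) (log 2 p)"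
        by (auto simp: eventually_at_filter)
    qed
  qed
  show "{0<..} \<subseteq> w ` {0<..}"
  proof
    fix s :: real assume "s \<in> {0<..}"
    then obtain p q where pq: "0 < p" "w p < s" "0 < q" "s \<le> w q"
      using small large by (meson greaterThan_iff)
    then have "p \<le> q"
      using mono[of q p] by (cases "p \<le> q") auto
    moreover have "continuous_on {p..q} w"
      using cont pq by (auto intro: continuous_on_subset)
    ultimately obtain t where "p \<le> t" "w t = s"
      using IVT'[of w p s q] pq by auto
    then show "s \<in> w ` {0<..}"
      using pq by (intro image_eqI[of _ _ t]) auto
  qed
qed

text \<open>
  The gain \<open>1 + g p\<close> reached by water-filling at level \<open>\<nu>\<close> is \<open>max 1 (\<nu> g)\<close>; with
  \<open>x / 0 = 0\<close> the formula below also allots no power to a vanishing gain.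
\<close>

definition waterfill :: "real \<Rightarrow> real \<Rightarrow> real" where
  "waterfill \<nu> g = (max 1 (\<nu> * g) - 1) / g"

lemma waterfill_bounds: "0 < \<nu> \<Longrightarrow> 0 \<le> g \<Longrightarrow> 0 \<le> waterfill \<nu> g \<and> waterfill \<nu> g \<le> \<nu>"
  by (cases "g = 0") (auto simp: waterfill_def pos_divide_le_eq max_def)

lemma gain_waterfill: "0 \<le> g \<Longrightarrow> 0 < \<nu> \<Longrightarrow> 1 + g * waterfill \<nu> g = max 1 (\<nu> * g)"
  by (cases "g = 0") (auto simp: waterfill_def)

text \<open>Pointwise Lagrangian bound with multiplier \<open>1 / (\<nu> * ln 2)\<close>: for a
  fixed gain, the rate minus the priced power is largest at the water-filling power. It comes from
  \<open>ln t \<le> t - 1\<close> at the ratio of the two gains.\<close>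

lemma waterfill_duality:
  assumes "0 < \<nu>" "0 \<le> g" "0 \<le> p"
  shows "log 2 (1 + g * p) \<le> log 2 (max 1 (\<nu> * g)) + (p - waterfill \<nu> g) / (\<nu> * ln 2)"
proof (cases "g = 0")
  case True
  then show ?thesis using assms by (simp add: waterfill_def)
next
  case False
  then have g: "0 < g" using assms by simp
  define a where "a = max 1 (\<nu> * g)"
  define b where "b = 1 + g * p"
  have ab: "1 \<le> a" "1 \<le> b"
    using assms by (auto simp: a_def b_def)
  have "ln b - ln a \<le> b / a - 1"
    using ab ln_le_minus_one[of "b / a"] by (simp add: ln_div)
  also have "\<dots> = (b - a) / a"
    using ab by (simp add: field_simps)
  \<comment> \<open>Above the threshold the denominators agree. Below it \<open>a = 1\<close>, so
    the numerator is nonnegative and the smaller denominator \<open>\<nu> * g\<close> only enlarges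
    the quotient.\<close>
  also have "\<dots> \<le> (b - a) / (\<nu> * g)"
  proof (cases "1 \<le> \<nu> * g")
    case False
    then have "a = 1" by (simp add: a_def)
    with ab False g assms show ?thesis
      by (intro divide_left_mono) auto
  qed (simp add: a_def)
  also have "\<dots> = (p - waterfill \<nu> g) / \<nu>"
    using g assms by (simp add: a_def b_def waterfill_def field_simps)
  finally have "ln b / ln 2 \<le> (ln a + (p - waterfill \<nu> g) / \<nu>) / ln 2"
    by (intro divide_right_mono) auto
  then show ?thesis
    by (simp add: a_def b_def log_def add_divide_distrib)
qed

text \<open>Concavity of the rate in the power, again from \<open>ln t \<le> t - 1\<close>.\<close>

lemma log_tangent:
  assumes "0 \<le> g" "0 \<le> p" "0 \<le> q"
  shows "log 2 (1 + g * q) \<le> log 2 (1 + g * p) + g / (1 + g * p) * ((q - p) / ln 2)"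
proof -
  have pos: "0 < 1 + g * p" "0 < 1 + g * q"
    using assms by (auto intro: add_pos_nonneg)
  have "ln (1 + g * q) - ln (1 + g * p) \<le> (1 + g * q) / (1 + g * p) - 1"
    using pos ln_le_minus_one[of "(1 + g * q) / (1 + g * p)"] by (simp add: ln_div)
  also have "\<dots> = g / (1 + g * p) * (q - p)"
    using pos by (simp add: field_simps)
  finally have "ln (1 + g * q) / ln 2 \<le> (ln (1 + g * p) + g / (1 + g * p) * (q - p)) / ln 2"
    by (intro divide_right_mono) auto
  then show ?thesis
    by (simp add: log_def add_divide_distrib)
qed

lemma log_max_mono: "x \<le> y \<Longrightarrow> log 2 (max 1 x) \<le> log 2 (max 1 y)"
  by (intro log_mono) (auto simp: max_def)

lemma log_max_le: "0 \<le> x \<Longrightarrow> log 2 (max 1 x) \<le> log 2 (1 + x)"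
  by (intro log_mono) (auto simp: max_def)

section \<open>Fading channels\<close>

text \<open>Almost sure positivity stands in for the density, so that a constant positive gain is an
  instance too.\<close>

locale fading = prob_space M for M :: "'a measure" +
  fixes G :: "'a \<Rightarrow> real"
  assumes G_measurable [measurable]: "G \<in> borel_measurable M"
    and G_nonneg: "\<omega> \<in> space M \<Longrightarrow> 0 \<le> G \<omega>"
    and G_pos: "AE \<omega> in M. 0 < G \<omega>"
    and rate_integrable: "0 \<le> p \<Longrightarrow> integrable M (\<lambda>\<omega>. log 2 (1 + G \<omega> * p))"
begin

definition rate :: "real \<Rightarrow> real" where
  "rate p = (\<integral>\<omega>. log 2 (1 + G \<omega> * p) \<partial>M)"

text \<open>Divided by \<open>ln 2\<close>, this is the slope of the concave function
  \<open>rate\<close>.\<close>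

definition marginal :: "real \<Rightarrow> real" where
  "marginal p = (\<integral>\<omega>. G \<omega> / (1 + G \<omega> * p) \<partial>M)"

definition wf_rate :: "real \<Rightarrow> real" where
  "wf_rate \<nu> = (\<integral>\<omega>. log 2 (max 1 (\<nu> * G \<omega>)) \<partial>M)"

definition wf_power :: "real \<Rightarrow> real" where
  "wf_power \<nu> = (\<integral>\<omega>. waterfill \<nu> (G \<omega>) \<partial>M)"

section \<open>Integrability of the fading integrands\<close>

lemma emeasure_space_nonzero: "emeasure M (space M) \<noteq> 0"
  by (simp add: emeasure_space_1)

lemma wf_rate_integrable:
  assumes "0 < \<nu>"
  shows "integrable M (\<lambda>\<omega>. log 2 (max 1 (\<nu> * G \<omega>)))"
proof (rule Bochner_Integration.integrable_bound)
  show "integrable M (\<lambda>\<omega>. log 2 (1 + G \<omega> * \<nu>))"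
    using assms by (intro rate_integrable) simp
  have "norm (log 2 (max 1 (\<nu> * G \<omega>))) \<le> norm (log 2 (1 + G \<omega> * \<nu>))" if "\<omega> \<in> space M" for \<omega>
  proof -
    have "0 \<le> log 2 (max 1 (\<nu> * G \<omega>))"
      by simp
    moreover have "log 2 (max 1 (\<nu> * G \<omega>)) \<le> log 2 (1 + G \<omega> * \<nu>)"
      using log_max_le[of "\<nu> * G \<omega>"] G_nonneg[OF that] assms by (simp add: mult.commute)
    ultimately show ?thesis by simp
  qed
  then show "AE \<omega> in M. norm (log 2 (max 1 (\<nu> * G \<omega>))) \<le> norm (log 2 (1 + G \<omega> * \<nu>))"
    by auto
qed measurable

lemma waterfill_measurable [measurable]: "waterfill \<nu> \<in> borel_measurable borel"
  unfolding waterfill_def by measurable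

lemma wf_power_integrable:
  assumes "0 < \<nu>"
  shows "integrable M (\<lambda>\<omega>. waterfill \<nu> (G \<omega>))"
  using waterfill_bounds[OF assms] G_nonneg
  by (intro integrable_const_bound[of _ \<nu>]) auto

lemma marginal_integrable:
  assumes "0 < p"
  shows "integrable M (\<lambda>\<omega>. G \<omega> / (1 + G \<omega> * p))"
proof (rule integrable_const_bound)
  have "norm (G \<omega> / (1 + G \<omega> * p)) \<le> 1 / p" if "\<omega> \<in> space M" for \<omega>
    using G_nonneg[OF that] assms by (simp add: field_simps add_pos_nonneg)
  then show "AE \<omega> in M. norm (G \<omega> / (1 + G \<omega> * p)) \<le> 1 / p"
    by auto
qed measurable

text \<open>Transfers small values from \<open>rate\<close> down to \<open>wf_rate\<close> and large
  values from \<open>wf_rate\<close> up to \<open>rate\<close>, so each property is proved only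
  once.\<close>

lemma wf_rate_le_rate: "0 < \<nu> \<Longrightarrow> wf_rate \<nu> \<le> rate \<nu>"
  unfolding wf_rate_def rate_def using G_nonneg
  by (intro integral_mono wf_rate_integrable rate_integrable)
    (auto simp: mult.commute intro!: log_max_le)

section \<open>Monotonicity, growth and range of the mean rates\<close>

lemma rate_zero: "rate 0 = 0"
  by (simp add: rate_def)

lemma rate_strict_mono:
  assumes "0 \<le> p" "p < q"
  shows "rate p < rate q"
  unfolding rate_def
proof (rule integral_less_AE_space)
  show "AE \<omega> in M. log 2 (1 + G \<omega> * p) < log 2 (1 + G \<omega> * q)"
    using G_pos
  proof eventually_elim
    case (elim \<omega>)
    then have "0 < 1 + G \<omega> * p" "G \<omega> * p < G \<omega> * q"
      using assms by (auto intro: add_pos_nonneg)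
    then show ?case by simp
  qed
qed (use assms emeasure_space_nonzero in \<open>auto intro: rate_integrable\<close>)

text \<open>Multiplying the power by \<open>q / p \<ge> 1\<close> multiplies
  \<open>1 + g * p\<close> by at most that factor.\<close>

lemma rate_growth:
  assumes "0 < p" "p \<le> q"
  shows "rate q \<le> rate p + log 2 (q / p)"
proof -
  have "rate q \<le> (\<integral>\<omega>. log 2 (1 + G \<omega> * p) + log 2 (q / p) \<partial>M)"
    unfolding rate_def
  proof (rule integral_mono)
    fix \<omega> assume "\<omega> \<in> space M"
    then have g: "0 \<le> G \<omega>" by (rule G_nonneg)
    have "1 + G \<omega> * q \<le> (1 + G \<omega> * p) * (q / p)"
      using g assms by (simp add: field_simps)
    then have "log 2 (1 + G \<omega> * q) \<le> log 2 ((1 + G \<omega> * p) * (q / p))"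
      using g assms by (intro log_mono) (auto intro: add_pos_nonneg)
    also have "\<dots> = log 2 (1 + G \<omega> * p) + log 2 (q / p)"
      using g assms by (intro log_mult_pos) (auto intro: add_pos_nonneg)
    finally show "log 2 (1 + G \<omega> * q) \<le> log 2 (1 + G \<omega> * p) + log 2 (q / p)" .
  qed (use assms in \<open>auto intro!: rate_integrable\<close>)
  then show ?thesis
    using assms rate_integrable[of p] by (simp add: rate_def prob_space)
qed

lemma wf_rate_mono:
  assumes "0 < \<mu>" "\<mu> \<le> \<nu>"
  shows "wf_rate \<mu> \<le> wf_rate \<nu>"
  unfolding wf_rate_def using assms G_nonneg
  by (intro integral_mono wf_rate_integrable log_max_mono mult_right_mono) auto

lemma wf_rate_growth:
  assumes "0 < p" "p \<le> q"
  shows "wf_rate q \<le> wf_rate p + log 2 (q / p)"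
proof -
  have "wf_rate q \<le> (\<integral>\<omega>. log 2 (max 1 (p * G \<omega>)) + log 2 (q / p) \<partial>M)"
    unfolding wf_rate_def
  proof (rule integral_mono)
    fix \<omega> assume "\<omega> \<in> space M"
    then have g: "0 \<le> G \<omega>" by (rule G_nonneg)
    have "1 * 1 \<le> max 1 (p * G \<omega>) * (q / p)" "p * G \<omega> * (q / p) \<le> max 1 (p * G \<omega>) * (q / p)"
      using g assms by (intro mult_mono mult_right_mono; simp)+
    then have "max 1 (q * G \<omega>) \<le> max 1 (p * G \<omega>) * (q / p)"
      using assms by (simp add: mult.commute)
    then have "log 2 (max 1 (q * G \<omega>)) \<le> log 2 (max 1 (p * G \<omega>) * (q / p))"
      by (intro log_mono) auto
    also have "\<dots> = log 2 (max 1 (p * G \<omega>)) + log 2 (q / p)"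
      using assms by (intro log_mult_pos) auto
    finally show "log 2 (max 1 (q * G \<omega>)) \<le> log 2 (max 1 (p * G \<omega>)) + log 2 (q / p)" .
  qed (use assms in \<open>auto intro!: wf_rate_integrable\<close>)
  then show ?thesis
    using assms wf_rate_integrable[of p] by (simp add: wf_rate_def prob_space)
qed

text \<open>Dominated convergence along the powers \<open>1 / Suc n\<close>, with the integrand at
  power 1 as the majorant.\<close>

lemma rate_small:
  assumes "0 < \<epsilon>"
  shows "\<exists>p>0. rate p < \<epsilon>"
proof -
  have "(\<lambda>n. \<integral>\<omega>. log 2 (1 + G \<omega> * (1 / Suc n)) \<partial>M) \<longlonglongrightarrow> (\<integral>\<omega>. 0 \<partial>M)"
  proof (rule integral_dominated_convergence)
    show "integrable M (\<lambda>\<omega>. log 2 (1 + G \<omega> * 1))"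
      by (intro rate_integrable) simp
    show "AE \<omega> in M. (\<lambda>n. log 2 (1 + G \<omega> * (1 / Suc n))) \<longlonglongrightarrow> 0"
    proof (intro AE_I2)
      fix \<omega>
      have "(\<lambda>n. 1 / real (Suc n)) \<longlonglongrightarrow> 0"
        using LIMSEQ_inverse_real_of_nat by (simp add: inverse_eq_divide)
      then have "(\<lambda>n. log 2 (1 + G \<omega> * (1 / Suc n))) \<longlonglongrightarrow> log 2 (1 + G \<omega> * 0)"
        by (intro tendsto_intros) auto
      then show "(\<lambda>n. log 2 (1 + G \<omega> * (1 / Suc n))) \<longlonglongrightarrow> 0" by simp
    qed
    fix n
    have "norm (log 2 (1 + G \<omega> * (1 / Suc n))) \<le> log 2 (1 + G \<omega> * 1)" if "\<omega> \<in> space M" for \<omega>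
    proof -
      have "G \<omega> * (1 / Suc n) \<le> G \<omega> * 1"
        using G_nonneg[OF that] by (intro mult_left_mono) auto
      moreover have "0 \<le> G \<omega> * (1 / Suc n)"
        using G_nonneg[OF that] by simp
      ultimately show ?thesis by simp
    qed
    then show "AE \<omega> in M. norm (log 2 (1 + G \<omega> * (1 / Suc n))) \<le> log 2 (1 + G \<omega> * 1)"
      by auto
  qed measurable
  then have "(\<lambda>n. rate (1 / Suc n)) \<longlonglongrightarrow> 0"
    by (simp add: rate_def)
  then have "\<forall>\<^sub>F n in sequentially. rate (1 / Suc n) < \<epsilon>"
    using assms by (rule order_tendstoD)
  then obtain n where "rate (1 / Suc n) < \<epsilon>"
    by (auto simp: eventually_sequentially)
  then show ?thesis
    by (intro exI[of _ "1 / Suc n"]) simp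
qed

text \<open>A gain that is almost surely positive exceeds some \<delta> with positive probability; a
  high level makes the rate on that event as large as desired.\<close>

lemma wf_rate_large: "\<exists>\<nu>>0. K \<le> wf_rate \<nu>"
proof -
  obtain n where n: "\<not> (AE \<omega> in M. G \<omega> \<le> 1 / Suc n)"
  proof (rule ccontr)
    assume "\<not> thesis"
    with that have "\<forall>n. AE \<omega> in M. G \<omega> \<le> 1 / Suc n" by blast
    then have "AE \<omega> in M. \<forall>n. G \<omega> \<le> 1 / Suc n" by (subst AE_all_countable)
    then have "AE \<omega> in M. False"
      using G_pos
    proof eventually_elim
      case (elim \<omega>)
      then show ?case using nat_approx_posE[of "G \<omega>"] by (metis not_less)
    qed
    then show False by simp
  qed
  define \<delta> where "\<delta> = 1 / real (Suc n)"
  have \<delta>: "0 < \<delta>" by (simp add: \<delta>_def)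
  define A where "A = {\<omega> \<in> space M. \<delta> < G \<omega>}"
  have A: "A \<in> sets M" unfolding A_def by measurable
  have "prob A \<noteq> 0"
  proof
    assume "prob A = 0"
    then have "AE \<omega> in M. \<omega> \<notin> A"
      using A prob_eq_0 by simp
    then have "AE \<omega> in M. G \<omega> \<le> 1 / Suc n"
      by (rule AE_mp) (auto simp: A_def \<delta>_def not_less)
    with n show False by blast
  qed
  then have q: "0 < prob A" by (simp add: less_le)
  \<comment> \<open>The level below gives \<open>\<nu> * G \<omega> \<ge> 2 powr k\<close> on
    \<open>A\<close>, hence a rate of at least \<open>k\<close> there; the choice of
    \<open>k\<close> compensates for the probability of \<open>A\<close>.\<close>
  define k where "k = max 0 (K / prob A)"
  define \<nu> where "\<nu> = 2 powr k / \<delta>"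
  have \<nu>: "0 < \<nu>" using \<delta> by (simp add: \<nu>_def)
  have "K / prob A * prob A \<le> k * prob A"
    by (intro mult_right_mono) (auto simp: k_def)
  then have "K \<le> k * prob A"
    using q by simp
  also have "\<dots> = (\<integral>\<omega>. k * indicator A \<omega> \<partial>M)"
    using A by simp
  also have "\<dots> \<le> wf_rate \<nu>"
    unfolding wf_rate_def
  proof (intro integral_mono wf_rate_integrable \<nu>)
    show "integrable M (\<lambda>\<omega>. k * indicator A \<omega>)"
      using A by (intro integrable_mult_right) (auto simp: emeasure_eq_measure)
    fix \<omega> assume "\<omega> \<in> space M"
    show "k * indicator A \<omega> \<le> log 2 (max 1 (\<nu> * G \<omega>))"
    proof (cases "\<omega> \<in> A")
      case True
      then have "2 powr k \<le> \<nu> * G \<omega>"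
        using \<delta> by (simp add: A_def \<nu>_def field_simps)
      then have "log 2 (2 powr k) \<le> log 2 (max 1 (\<nu> * G \<omega>))"
        by (intro log_mono) auto
      with True show ?thesis by simp
    qed auto
  qed
  finally show ?thesis using \<nu> by blast
qed

lemma wf_rate_small: "0 < \<epsilon> \<Longrightarrow> \<exists>\<nu>>0. wf_rate \<nu> < \<epsilon>"
  using rate_small wf_rate_le_rate by (meson le_less_trans)

lemma rate_large: "\<exists>p>0. K \<le> rate p"
  using wf_rate_large[of K] wf_rate_le_rate by (meson order_trans)

lemma rate_onto: "rate ` {0<..} = {0<..}"
proof
  show "rate ` {0<..} \<subseteq> {0<..}"
    using rate_strict_mono[of 0] rate_zero by auto
  show "{0<..} \<subseteq> rate ` {0<..}"
  proof (rule log_growth_onto(2))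
    show "rate p \<le> rate q" if "0 < p" "p \<le> q" for p q
      using rate_strict_mono[of p q] that by (cases "p = q") auto
  qed (auto intro: rate_growth rate_small rate_large)
qed

lemma wf_rate_continuous: "continuous_on {0<..} wf_rate"
  by (rule log_growth_onto(1)) (auto intro: wf_rate_mono wf_rate_growth wf_rate_small wf_rate_large)

text \<open>Levels of zero rate are left out: when the gain is bounded, low levels allot no power at
  all, and \<open>wf_rate\<close> is strictly increasing only beyond them.\<close>

lemma wf_rate_onto: "wf_rate ` {\<nu>. 0 < \<nu> \<and> 0 < wf_rate \<nu>} = {0<..}"
proof -
  have "{0<..} \<subseteq> wf_rate ` {0<..}"
    by (rule log_growth_onto(2)) (auto intro: wf_rate_mono wf_rate_growth wf_rate_small wf_rate_large)
  then show ?thesis by force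
qed

lemma wf_levels_open: "open {\<nu>. 0 < \<nu> \<and> 0 < wf_rate \<nu>}"
proof -
  have "open ({0<..} \<inter> wf_rate -` {0<..})"
    by (intro continuous_open_preimage wf_rate_continuous) auto
  moreover have "{0<..} \<inter> wf_rate -` {0<..} = {\<nu>. 0 < \<nu> \<and> 0 < wf_rate \<nu>}"
    by auto
  ultimately show ?thesis by simp
qed

text \<open>The integrands differ on the event that power is allotted at level \<mu>; it has
  positive probability, as the rate would vanish otherwise.\<close>

lemma wf_rate_strict_mono:
  assumes "0 < \<mu>" "0 < wf_rate \<mu>" "\<mu> < \<nu>"
  shows "wf_rate \<mu> < wf_rate \<nu>"
  unfolding wf_rate_def
proof (rule integral_less_AE)
  define A where "A = {\<omega> \<in> space M. 1 < \<mu> * G \<omega>}"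
  show A: "A \<in> sets M" unfolding A_def by measurable
  show "emeasure M A \<noteq> 0"
  proof
    assume "emeasure M A = 0"
    then have "AE \<omega> in M. \<not> 1 < \<mu> * G \<omega>"
      using A unfolding A_def by (subst AE_iff_measurable[OF _ refl]) auto
    then have "wf_rate \<mu> = (\<integral>\<omega>. 0 \<partial>M)"
      unfolding wf_rate_def by (intro integral_cong_AE) auto
    with assms(2) show False by simp
  qed
  show "AE \<omega> in M. \<omega> \<in> A \<longrightarrow> log 2 (max 1 (\<mu> * G \<omega>)) \<noteq> log 2 (max 1 (\<nu> * G \<omega>))"
  proof (intro AE_I2 impI)
    fix \<omega> assume "\<omega> \<in> A"
    then have *: "1 < \<mu> * G \<omega>" "0 < G \<omega>"
      using assms(1) G_nonneg[of \<omega>] by (auto simp: A_def less_le)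
    then have "\<mu> * G \<omega> < \<nu> * G \<omega>"
      using assms by simp
    then have "log 2 (max 1 (\<mu> * G \<omega>)) < log 2 (max 1 (\<nu> * G \<omega>))"
      using * by (intro log_less) linarith+
    then show "log 2 (max 1 (\<mu> * G \<omega>)) \<noteq> log 2 (max 1 (\<nu> * G \<omega>))" by (rule less_imp_neq)
  qed
  show "AE \<omega> in M. log 2 (max 1 (\<mu> * G \<omega>)) \<le> log 2 (max 1 (\<nu> * G \<omega>))"
    using assms G_nonneg by (intro AE_I2 log_max_mono mult_right_mono) auto
qed (use assms in \<open>auto intro: wf_rate_integrable\<close>)

section \<open>Known gain distribution: slopes of the mean rate\<close>

lemma rate_tangent:
  assumes "0 < p" "0 \<le> q"
  shows "rate q \<le> rate p + marginal p * ((q - p) / ln 2)"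
proof -
  have "rate q \<le> (\<integral>\<omega>. log 2 (1 + G \<omega> * p) + G \<omega> / (1 + G \<omega> * p) * ((q - p) / ln 2) \<partial>M)"
    unfolding rate_def using assms G_nonneg
    by (intro integral_mono log_tangent Bochner_Integration.integrable_add rate_integrable
        integrable_mult_left marginal_integrable) auto
  also have "\<dots> = rate p + marginal p * ((q - p) / ln 2)"
    unfolding rate_def marginal_def using assms
    by (subst Bochner_Integration.integral_add)
      (auto intro!: rate_integrable marginal_integrable integrable_mult_left
        simp del: times_divide_eq_right times_divide_eq_left)
  finally show ?thesis .
qed

lemma marginal_pos:
  assumes "0 < p"
  shows "0 < marginal p"
proof -
  have "(\<integral>\<omega>. 0 \<partial>M) < marginal p"
    unfolding marginal_def
    using G_pos assms emeasure_space_nonzero marginal_integrable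
    by (intro integral_less_AE_space) (auto elim!: eventually_mono intro!: divide_pos_pos add_pos_pos)
  then show ?thesis by simp
qed

lemma marginal_bound:
  assumes "0 < p"
  shows "p * marginal p \<le> 1"
proof -
  have "marginal p \<le> (\<integral>\<omega>. 1 / p \<partial>M)"
    unfolding marginal_def
  proof (intro integral_mono marginal_integrable assms)
    fix \<omega> assume "\<omega> \<in> space M"
    from G_nonneg[OF this] assms show "G \<omega> / (1 + G \<omega> * p) \<le> 1 / p"
      by (simp add: field_simps add_pos_nonneg)
  qed simp
  then show ?thesis
    using assms by (simp add: prob_space field_simps)
qed

lemma marginal_strict_antimono:
  assumes "0 < p" "p < q"
  shows "marginal q < marginal p"
  unfolding marginal_def
proof (rule integral_less_AE_space)
  show "AE \<omega> in M. G \<omega> / (1 + G \<omega> * q) < G \<omega> / (1 + G \<omega> * p)"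
    using G_pos
  proof eventually_elim
    case (elim \<omega>)
    then have "0 < 1 + G \<omega> * p" "0 < 1 + G \<omega> * q" "G \<omega> * p < G \<omega> * q"
      using assms by (auto intro: add_pos_nonneg)
    with elim show ?case by (intro divide_strict_left_mono mult_pos_pos) linarith+
  qed
qed (use assms emeasure_space_nonzero in \<open>auto intro: marginal_integrable\<close>)

lemma marginal_ratio:
  assumes "0 < p" "p \<le> q"
  shows "p * marginal p \<le> q * marginal q"
proof -
  have "(\<integral>\<omega>. p * (G \<omega> / (1 + G \<omega> * p)) \<partial>M) \<le> (\<integral>\<omega>. q * (G \<omega> / (1 + G \<omega> * q)) \<partial>M)"
  proof (rule integral_mono)
    fix \<omega> assume "\<omega> \<in> space M"
    then have g: "0 \<le> G \<omega>" by (rule G_nonneg)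
    have "0 < 1 + G \<omega> * p" "0 < 1 + G \<omega> * q"
      using g assms by (auto intro: add_pos_nonneg)
    with g assms show "p * (G \<omega> / (1 + G \<omega> * p)) \<le> q * (G \<omega> / (1 + G \<omega> * q))"
      by (simp add: field_simps mult_right_mono)
  qed (use assms in \<open>auto intro!: integrable_mult_right marginal_integrable simp del: times_divide_eq_right\<close>)
  then show ?thesis
    using assms by (simp add: marginal_def del: times_divide_eq_right)
qed

text \<open>\<open>marginal\<close> decreases while \<open>p * marginal p\<close> does not, so
  \<open>marginal q\<close> is squeezed between \<open>marginal p\<close> and
  \<open>marginal p * (p / q)\<close>.\<close>

lemma marginal_continuous: "continuous_on {0<..} marginal"
  unfolding continuous_on_def
proof
  fix p :: real assume "p \<in> {0<..}"
  then have p: "0 < p" by simp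
  have bound: "dist (marginal q) (marginal p) \<le> dist (marginal p * (p / q)) (marginal p)" if "0 < q" for q
  proof (cases "p \<le> q")
    case True
    then have "marginal q \<le> marginal p"
      using marginal_strict_antimono[of p q] p by (cases "p = q") auto
    moreover have "marginal p * (p / q) \<le> marginal q"
      using marginal_ratio[OF p True] that by (simp add: field_simps)
    ultimately show ?thesis by (simp add: dist_real_def)
  next
    case False
    then have "marginal p \<le> marginal q"
      using marginal_strict_antimono[of q p] that by simp
    moreover have "marginal q \<le> marginal p * (p / q)"
      using marginal_ratio[of q p] False that by (simp add: field_simps)
    ultimately show ?thesis by (simp add: dist_real_def)
  qed
  show "(marginal \<longlongrightarrow> marginal p) (at p within {0<..})"
  proof (rule metric_tendsto_imp_tendsto)
    have "((\<lambda>q. marginal p * (p / q)) \<longlongrightarrow> marginal p * (p / p)) (at p within {0<..})"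
      using p by (intro tendsto_intros) auto
    then show "((\<lambda>q. marginal p * (p / q)) \<longlongrightarrow> marginal p) (at p within {0<..})"
      using p by simp
    show "\<forall>\<^sub>F q in at p within {0<..}. dist (marginal q) (marginal p) \<le> dist (marginal p * (p / q)) (marginal p)"
      using bound by (auto simp: eventually_at_filter)
  qed
qed

lemma min_power_unknown:
  assumes "0 \<le> p"
  shows "min_power (Fast_Unknown M G) (rate p) = p"
proof -
  have "(LEAST q. 0 \<le> q \<and> rate p \<le> rate q) = p"
  proof (rule Least_equality)
    fix q assume "0 \<le> q \<and> rate p \<le> rate q"
    then show "p \<le> q" using rate_strict_mono[of q p] by (cases "p \<le> q") auto
  qed (use assms in simp)
  then show ?thesis by (simp add: rate_def)
qed

text \<open>The minimum power inverts the concave function \<open>rate\<close>, so its slope at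
  \<open>rate p\<close> is the reciprocal \<open>ln 2 / marginal p\<close>.\<close>

lemma min_power_unknown_smooth_convex:
  obtains d where "smooth_convex (min_power (Fast_Unknown M G)) d" "strict_mono_on {0<..} d"
    "\<And>K. \<exists>x>0. K \<le> d x"
proof -
  let ?\<rho> = "min_power (Fast_Unknown M G)"
  have inv: "\<exists>p\<ge>0. s = rate p \<and> ?\<rho> s = p" if "0 \<le> s" for s
  proof (cases "s = 0")
    case True
    then show ?thesis
      using min_power_unknown[of 0] rate_zero by auto
  next
    case False
    then have "s \<in> rate ` {0<..}"
      using that rate_onto by auto
    then show ?thesis
      using min_power_unknown by force
  qed
  show thesis
  proof (rule smooth_convex_parametric[of ?\<rho> "{0<..}" rate "\<lambda>p. ln 2 / marginal p"])
    show "?\<rho> 0 = 0"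
      using min_power_unknown[of 0] rate_zero by simp
    show "0 \<le> ?\<rho> x" if "0 \<le> x" for x
      using inv[OF that] by auto
    show "strict_mono_on {0<..} rate"
      by (auto simp: strict_mono_on_def intro: rate_strict_mono)
    show "strict_mono_on {0<..} (\<lambda>p. ln 2 / marginal p)"
      by (auto simp: strict_mono_on_def
          intro!: divide_strict_left_mono marginal_strict_antimono mult_pos_pos marginal_pos)
    show "continuous_on {0<..} (\<lambda>p. ln 2 / marginal p)"
      using marginal_pos by (intro continuous_intros marginal_continuous) force
    show "\<exists>p\<in>{0<..}. K \<le> ln 2 / marginal p" for K
    proof
      \<comment> \<open>\<open>marginal_bound\<close> gives
        \<open>ln 2 / marginal p \<ge> p * ln 2\<close>, so a power of at least
        \<open>K / ln 2\<close> suffices.\<close>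
      let ?p = "max 1 (K / ln 2)"
      have "K / ln 2 * marginal ?p \<le> ?p * marginal ?p"
        using marginal_pos[of ?p] by (intro mult_right_mono) (auto simp: less_max_iff_disj)
      also have "\<dots> \<le> 1" by (rule marginal_bound) simp
      finally show "K \<le> ln 2 / marginal ?p"
        using marginal_pos[of ?p] by (simp add: field_simps)
    qed simp
    show "?\<rho> (rate p) + ln 2 / marginal p * (y - rate p) \<le> ?\<rho> y" if "p \<in> {0<..}" "0 \<le> y" for p y
    proof -
      obtain q where q: "0 \<le> q" "y = rate q" "?\<rho> y = q"
        using inv[OF \<open>0 \<le> y\<close>] by auto
      have "y - rate p \<le> marginal p * ((q - p) / ln 2)"
        using rate_tangent[of p q] q that by simp
      then have "ln 2 / marginal p * (y - rate p) \<le> ln 2 / marginal p * (marginal p * ((q - p) / ln 2))"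
        using marginal_pos[of p] that by (intro mult_left_mono) auto
      also have "\<dots> = q - p"
        using marginal_pos[of p] that by simp
      finally show ?thesis
        using q that min_power_unknown[of p] by simp
    qed
  qed (auto simp: rate_onto intro: that)
qed

section \<open>Known gain: duality and water-filling\<close>

definition policies :: "real \<Rightarrow> (real \<Rightarrow> real) set" where
  "policies s = {p \<in> borel_measurable (restrict_space borel {0..}). (\<forall>g\<ge>0. 0 \<le> p g) \<and>
     ennreal s \<le> (\<integral>\<^sup>+\<omega>. ennreal (log 2 (1 + G \<omega> * p (G \<omega>))) \<partial>M)}"

lemma min_power_known:
  "min_power (Fast_Known M G) s =
    enn2real (LEAST e. e \<in> (\<lambda>p. \<integral>\<^sup>+\<omega>. ennreal (p (G \<omega>)) \<partial>M) ` policies s)"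
  by (simp add: policies_def image_def Bex_def conj_ac)

text \<open>Weak duality, by integrating \<open>waterfill_duality\<close>. As a function of
  \<open>s\<close> the bound is a line of slope \<open>\<nu> * ln 2\<close>, which becomes the
  tangent to the minimum power at \<open>wf_rate \<nu>\<close>.\<close>

lemma policy_lower_bound:
  assumes "0 < \<nu>" "p \<in> policies s" "0 \<le> s"
  shows "ennreal (wf_power \<nu> + \<nu> * ln 2 * (s - wf_rate \<nu>)) \<le> (\<integral>\<^sup>+\<omega>. ennreal (p (G \<omega>)) \<partial>M)"
\<comment> \<open>Policies of infinite mean power satisfy the bound trivially; for the others the
  extended integrals become real ones.\<close>
proof (cases "(\<integral>\<^sup>+\<omega>. ennreal (p (G \<omega>)) \<partial>M) = \<infinity>")
  case False
  have "G \<in> measurable M (restrict_space borel {0..})"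
    using G_nonneg by (intro measurable_restrict_space2) auto
  moreover have "p \<in> borel_measurable (restrict_space borel {0..})"
    using assms by (simp add: policies_def)
  ultimately have [measurable]: "(\<lambda>\<omega>. p (G \<omega>)) \<in> borel_measurable M"
    by (rule measurable_compose)
  have nonneg: "0 \<le> p (G \<omega>)" if "\<omega> \<in> space M" for \<omega>
    using assms G_nonneg[OF that] by (simp add: policies_def)
  have int_p: "integrable M (\<lambda>\<omega>. p (G \<omega>))"
    using False nonneg by (intro integrableI_nonneg) (auto simp: less_top)
  define u where "u = (\<lambda>\<omega>. log 2 (max 1 (\<nu> * G \<omega>)) + (p (G \<omega>) - waterfill \<nu> (G \<omega>)) / (\<nu> * ln 2))"
  have int_u: "integrable M u"
    unfolding u_def using assms int_p wf_rate_integrable wf_power_integrable by auto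
  have le_u: "log 2 (1 + G \<omega> * p (G \<omega>)) \<le> u \<omega>" if "\<omega> \<in> space M" for \<omega>
    unfolding u_def using assms nonneg[OF that] G_nonneg[OF that] by (intro waterfill_duality)
  \<comment> \<open>Needed to identify the extended integral of \<open>u\<close> with its real
    integral.\<close>
  have nonneg_u: "0 \<le> u \<omega>" if "\<omega> \<in> space M" for \<omega>
  proof -
    have "log 2 1 \<le> log 2 (1 + G \<omega> * p (G \<omega>))"
      using nonneg[OF that] G_nonneg[OF that] by (intro log_mono) auto
    with le_u[OF that] show ?thesis by simp
  qed
  have "ennreal s \<le> (\<integral>\<^sup>+\<omega>. ennreal (log 2 (1 + G \<omega> * p (G \<omega>))) \<partial>M)"
    using assms by (simp add: policies_def)
  also have "\<dots> \<le> (\<integral>\<^sup>+\<omega>. ennreal (u \<omega>) \<partial>M)"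
    using le_u by (intro nn_integral_mono ennreal_leI)
  also have "\<dots> = ennreal (\<integral>\<omega>. u \<omega> \<partial>M)"
    using int_u nonneg_u by (intro nn_integral_eq_integral) auto
  finally have "s \<le> (\<integral>\<omega>. u \<omega> \<partial>M)"
    using nonneg_u by (subst (asm) ennreal_le_iff) (auto intro: integral_nonneg)
  also have "\<dots> = wf_rate \<nu> + ((\<integral>\<omega>. p (G \<omega>) \<partial>M) - wf_power \<nu>) / (\<nu> * ln 2)"
    unfolding u_def wf_rate_def wf_power_def
    using assms int_p wf_rate_integrable wf_power_integrable by simp
  finally have "wf_power \<nu> + \<nu> * ln 2 * (s - wf_rate \<nu>) \<le> (\<integral>\<omega>. p (G \<omega>) \<partial>M)"
    using assms by (simp add: field_simps)
  moreover have "(\<integral>\<^sup>+\<omega>. ennreal (p (G \<omega>)) \<partial>M) = ennreal (\<integral>\<omega>. p (G \<omega>) \<partial>M)"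
    using int_p nonneg by (intro nn_integral_eq_integral) auto
  ultimately show ?thesis
    by (simp add: ennreal_leI)
qed simp

lemma waterfill_policy:
  assumes "0 < \<nu>"
  shows "waterfill \<nu> \<in> policies (wf_rate \<nu>)"
proof -
  have "(\<integral>\<^sup>+\<omega>. ennreal (log 2 (1 + G \<omega> * waterfill \<nu> (G \<omega>))) \<partial>M) =
      (\<integral>\<^sup>+\<omega>. ennreal (log 2 (max 1 (\<nu> * G \<omega>))) \<partial>M)"
    using assms G_nonneg by (intro nn_integral_cong) (simp add: gain_waterfill)
  also have "\<dots> = ennreal (wf_rate \<nu>)"
    unfolding wf_rate_def using assms by (intro nn_integral_eq_integral wf_rate_integrable) auto
  finally show ?thesis
    using assms waterfill_bounds by (simp add: policies_def measurable_restrict_space1)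
qed

lemma nn_integral_waterfill:
  "0 < \<nu> \<Longrightarrow> (\<integral>\<^sup>+\<omega>. ennreal (waterfill \<nu> (G \<omega>)) \<partial>M) = ennreal (wf_power \<nu>)"
  unfolding wf_power_def using waterfill_bounds G_nonneg
  by (intro nn_integral_eq_integral wf_power_integrable) auto

lemma wf_power_nonneg: "0 < \<nu> \<Longrightarrow> 0 \<le> wf_power \<nu>"
  unfolding wf_power_def using waterfill_bounds G_nonneg by (intro integral_nonneg_AE) auto

lemma zero_policy: "(\<lambda>_. 0) \<in> policies 0"
  by (simp add: policies_def)

lemma min_power_known_zero: "min_power (Fast_Known M G) 0 = 0"
proof -
  have "(LEAST e. e \<in> (\<lambda>p. \<integral>\<^sup>+\<omega>. ennreal (p (G \<omega>)) \<partial>M) ` policies 0) = 0"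
    using zero_policy by (intro Least_equality) (auto intro!: image_eqI[OF _ zero_policy])
  then show ?thesis
    unfolding min_power_known by simp
qed

text \<open>At this rate the dual bound reduces to \<open>wf_power \<nu>\<close>, which
  water-filling attains; the least element therefore exists and is finite.\<close>

lemma min_power_known_wf_rate:
  assumes "0 < \<nu>"
  shows "min_power (Fast_Known M G) (wf_rate \<nu>) = wf_power \<nu>"
proof -
  have "0 \<le> wf_rate \<nu>"
    unfolding wf_rate_def by (intro integral_nonneg_AE) auto
  then have "(LEAST e. e \<in> (\<lambda>p. \<integral>\<^sup>+\<omega>. ennreal (p (G \<omega>)) \<partial>M) ` policies (wf_rate \<nu>)) = ennreal (wf_power \<nu>)"
    using assms policy_lower_bound[OF assms, of _ "wf_rate \<nu>"]
    by (intro Least_equality)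
      (auto intro!: image_eqI[OF _ waterfill_policy] simp: nn_integral_waterfill)
  then show ?thesis
    unfolding min_power_known using wf_power_nonneg[OF assms] by simp
qed

lemma min_power_known_smooth_convex:
  obtains d where "smooth_convex (min_power (Fast_Known M G)) d" "strict_mono_on {0<..} d"
    "\<And>K. \<exists>x>0. K \<le> d x"
proof -
  let ?\<rho> = "min_power (Fast_Known M G)"
  \<comment> \<open>Rate 0 is not parametrised by the admissible levels and needs the zero
    policy.\<close>
  have attained: "0 \<le> ?\<rho> s \<and> (\<exists>p\<in>policies s. (\<integral>\<^sup>+\<omega>. ennreal (p (G \<omega>)) \<partial>M) = ennreal (?\<rho> s))"
    if "0 \<le> s" for s
  proof (cases "s = 0")
    case True
    then show ?thesis
      using zero_policy min_power_known_zero by force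
  next
    case False
    then have "s \<in> wf_rate ` {\<nu>. 0 < \<nu> \<and> 0 < wf_rate \<nu>}"
      using that wf_rate_onto by auto
    then show ?thesis
      using min_power_known_wf_rate waterfill_policy nn_integral_waterfill wf_power_nonneg by force
  qed
  show thesis
  proof (rule smooth_convex_parametric[of ?\<rho> "{\<nu>. 0 < \<nu> \<and> 0 < wf_rate \<nu>}" wf_rate "\<lambda>\<nu>. \<nu> * ln 2"])
    show "strict_mono_on {\<nu>. 0 < \<nu> \<and> 0 < wf_rate \<nu>} wf_rate"
      by (auto simp: strict_mono_on_def intro: wf_rate_strict_mono)
    show "strict_mono_on {\<nu>. 0 < \<nu> \<and> 0 < wf_rate \<nu>} (\<lambda>\<nu>. \<nu> * ln 2)"
      by (auto simp: strict_mono_on_def)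
    show "continuous_on {\<nu>. 0 < \<nu> \<and> 0 < wf_rate \<nu>} (\<lambda>\<nu>. \<nu> * ln 2)"
      by (intro continuous_intros)
    show "\<exists>\<nu>\<in>{\<nu>. 0 < \<nu> \<and> 0 < wf_rate \<nu>}. K \<le> \<nu> * ln 2" for K
    proof -
      \<comment> \<open>Raising a level of positive rate to at least \<open>K / ln 2\<close> keeps
        its rate positive.\<close>
      obtain \<nu> where \<nu>: "0 < \<nu>" "1 \<le> wf_rate \<nu>"
        using wf_rate_large by blast
      then have "1 \<le> wf_rate (max \<nu> (K / ln 2))"
        using wf_rate_mono[of \<nu> "max \<nu> (K / ln 2)"] by simp
      moreover have "K \<le> max \<nu> (K / ln 2) * ln 2"
        by (simp add: pos_divide_le_eq[symmetric])
      ultimately show ?thesis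
        using \<nu> by (intro bexI[of _ "max \<nu> (K / ln 2)"]) auto
    qed
    show "?\<rho> (wf_rate \<nu>) + \<nu> * ln 2 * (y - wf_rate \<nu>) \<le> ?\<rho> y"
      if "\<nu> \<in> {\<nu>. 0 < \<nu> \<and> 0 < wf_rate \<nu>}" "0 \<le> y" for \<nu> y
    proof -
      obtain p where "0 \<le> ?\<rho> y" "p \<in> policies y"
        "(\<integral>\<^sup>+\<omega>. ennreal (p (G \<omega>)) \<partial>M) = ennreal (?\<rho> y)"
        using attained[OF \<open>0 \<le> y\<close>] by blast
      then have "wf_power \<nu> + \<nu> * ln 2 * (y - wf_rate \<nu>) \<le> ?\<rho> y"
        using policy_lower_bound[of \<nu> p y] that by (simp add: ennreal_le_iff del: min_power.simps)
      then show ?thesis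
        using that by (simp add: min_power_known_wf_rate del: min_power.simps)
    qed
  qed (use attained wf_levels_open min_power_known_zero in \<open>auto simp: wf_rate_onto intro: that\<close>)
qed

end

text \<open>A law with a density has no atom at 0, so a nonnegative gain is almost surely
  positive.\<close>

lemma fading_gain_imp_fading:
  assumes "fading_gain M G"
  shows "fading M G"
proof -
  interpret prob_space M
    using assms by (simp add: fading_gain_def)
  obtain h where h: "distributed M lborel G h"
    using assms by (auto simp: fading_gain_def)
  then have G: "G \<in> borel_measurable M"
    using distributed_measurable[OF h] by simp
  have "AE x in lborel. x \<noteq> (0::real)"
    by (rule AE_lborel_singleton)
  then have "AE x in density lborel h. x \<noteq> 0"
    using distributed_borel_measurable[OF h] by (subst AE_density) auto
  then have "AE x in distr M lborel G. x \<noteq> 0"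
    unfolding distributed_distr_eq_density[OF h] .
  then have "AE \<omega> in M. G \<omega> \<noteq> 0"
    using G by (subst (asm) AE_distr_iff) auto
  then have "AE \<omega> in M. 0 < G \<omega>"
    using AE_space
  proof eventually_elim
    case (elim \<omega>)
    then show ?case
      using assms by (simp add: fading_gain_def less_le)
  qed
  then show ?thesis
    using assms G by unfold_locales (auto simp: fading_gain_def)
qed

lemma min_power_smooth_convex:
  assumes "valid_channel C"
  obtains d where "smooth_convex (min_power C) d" "strict_mono_on {0<..} d"
    "\<And>K. \<exists>x>0. K \<le> d x"
proof (cases C)
  case (Static g)
  let ?M = "measure_pmf (return_pmf ())"
  have "fading ?M (\<lambda>_. g)"
    using assms Static by unfold_locales auto
  moreover have "min_power C = min_power (Fast_Unknown ?M (\<lambda>_. g))"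
    using Static by (auto simp: measure_pmf.prob_space)
  ultimately show thesis
    using that by (metis fading.min_power_unknown_smooth_convex)
next
  case (Fast_Unknown M G)
  then have "fading M G"
    using assms by (simp add: fading_gain_imp_fading)
  then show thesis
    using that by (metis Fast_Unknown fading.min_power_unknown_smooth_convex)
next
  case (Fast_Known M G)
  then have "fading M G"
    using assms by (simp add: fading_gain_imp_fading)
  then show thesis
    using that by (metis Fast_Known fading.min_power_known_smooth_convex)
qed

section \<open>Energy per bit\<close>

text \<open>At \<open>x / 2\<close> the graph lies strictly below the chord from 0 to
  \<open>x\<close> and not below the tangent at \<open>x\<close>.\<close>

lemma strictly_convex_gap_pos:
  assumes sc: "smooth_convex \<psi> e" and "strictly_convex_on {0..} \<psi>" and x: "0 < x"
  shows "0 < gap \<psi> e x"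
proof -
  have "\<psi> ((1 - 1/2) * 0 + 1/2 * x) < (1 - 1/2) * \<psi> 0 + 1/2 * \<psi> x"
    using assms(2)[unfolded strictly_convex_on_def] x
    by (elim conjE) (drule bspec[of _ _ 0], simp, drule bspec[of _ _ x], simp, drule spec[of _ "1/2"], simp)
  moreover have "\<psi> x + e x * (x / 2 - x) \<le> \<psi> (x / 2)"
    using x by (intro smooth_convex_tangent[OF sc]) auto
  ultimately show ?thesis
    using smooth_convex_zero[OF sc] by (simp add: gap_def field_simps)
qed

lemma strictly_convex_on_scale:
  assumes "strictly_convex_on {0..} \<phi>" "0 < B"
  shows "strictly_convex_on {0..} (\<lambda>s. \<phi> (B * s))"
  unfolding strictly_convex_on_def
proof (intro conjI ballI allI impI)
  fix x y t :: real
  assume "x \<in> {0..}" "y \<in> {0..}" "x \<noteq> y \<and> 0 < t \<and> t < 1"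
  then have "\<phi> ((1 - t) * (B * x) + t * (B * y)) < (1 - t) * \<phi> (B * x) + t * \<phi> (B * y)"
    using assms by (simp add: strictly_convex_on_def)
  then show "\<phi> (B * ((1 - t) * x + t * y)) < (1 - t) * \<phi> (B * x) + t * \<phi> (B * y)"
    by (simp add: algebra_simps)
qed simp

text \<open>The tangent inequality at \<open>x\<close>, tested at 0 and at \<open>2 * x\<close>,
  forces \<open>e x = B\<close>.\<close>

lemma linear_gap_zero:
  assumes sc: "smooth_convex \<psi> e" and "\<And>s. 0 \<le> s \<Longrightarrow> \<psi> s = B * s" and x: "0 < x"
  shows "gap \<psi> e x = 0"
proof -
  have "\<psi> x + e x * (0 - x) \<le> \<psi> 0" "\<psi> x + e x * (2 * x - x) \<le> \<psi> (2 * x)"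
    using x by (intro smooth_convex_tangent[OF sc]; simp)+
  then show ?thesis
    using x assms(2)[of x] assms(2)[of 0] assms(2)[of "2 * x"] by (simp add: gap_def algebra_simps)
qed

text \<open>The tangent at \<open>x\<close>, evaluated at 1, gives
  \<open>gap \<psi> e x \<ge> e x - \<psi> 1\<close>.\<close>

lemma gap_unbounded:
  assumes sc: "smooth_convex \<psi> e" and large: "\<And>K. \<exists>x>0. K \<le> e x"
  shows "\<exists>x>0. K \<le> gap \<psi> e x"
proof -
  obtain x where x: "0 < x" "K + \<psi> 1 \<le> e x"
    using large by blast
  have "\<psi> x + e x * (1 - x) \<le> \<psi> 1"
    using x by (intro smooth_convex_tangent[OF sc]) auto
  with x show ?thesis
    by (intro exI[of _ x]) (simp add: gap_def algebra_simps)
qed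

text \<open>The three channel cases enter only through the properties of \<open>min_power C\<close>.
  The slope \<open>e\<close> is taken with respect to the spectral efficiency, so it contains the
  factor \<open>B\<close>.\<close>

locale power_model =
  fixes B \<sigma> \<xi> P\<^sub>c :: real and \<phi> :: "real \<Rightarrow> real" and C :: "'a channel"
    and \<alpha> :: real and e d :: "real \<Rightarrow> real"
  assumes B: "0 < B" and \<alpha>: "\<alpha> = \<sigma>\<^sup>2 / \<xi>" "0 < \<alpha>" and P\<^sub>c: "0 < P\<^sub>c"
    and circuit: "smooth_convex (\<lambda>s. \<phi> (B * s)) e"
    and circuit_pos: "\<And>s. 0 < s \<Longrightarrow> 0 < \<phi> (B * s)"
    and power: "smooth_convex (min_power C) d"
    and slope_strict: "strict_mono_on {0<..} d"
    and slope_large: "\<And>K. \<exists>x>0. K \<le> d x"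
begin

abbreviation variable_power :: "real \<Rightarrow> real \<Rightarrow> real" where
  "variable_power \<kappa> s \<equiv> \<kappa> * \<phi> (B * s) + \<alpha> * min_power C s"

abbreviation slope :: "real \<Rightarrow> real \<Rightarrow> real" where
  "slope \<kappa> s \<equiv> \<kappa> * e s + \<alpha> * d s"

abbreviation "circuit_gap \<equiv> gap (\<lambda>s. \<phi> (B * s)) e"

abbreviation "power_gap s \<equiv> \<alpha> * gap (min_power C) d s"

abbreviation "\<E> \<equiv> energy_per_bit B \<sigma> \<xi> P\<^sub>c \<phi> C"

abbreviation "rate_opt \<equiv> opt_rate B \<sigma> \<xi> P\<^sub>c \<phi> C"

section \<open>First-order condition and the optimum for a fixed coefficient\<close>

lemma variable_power_smooth_convex:
  "0 \<le> \<kappa> \<Longrightarrow> smooth_convex (variable_power \<kappa>) (slope \<kappa>)"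
  using \<alpha>(2) by (intro smooth_convex_combine circuit power) auto

lemma slope_strict_mono: "0 \<le> \<kappa> \<Longrightarrow> strict_mono_on {0<..} (slope \<kappa>)"
  using \<alpha>(2) smooth_convex_slope_mono[OF circuit] slope_strict
  by (auto simp: strict_mono_on_def intro!: add_le_less_mono mult_left_mono mult_strict_left_mono)

lemma gap_variable_power:
  "gap (variable_power \<kappa>) (slope \<kappa>) s = \<kappa> * circuit_gap s + power_gap s"
  by (rule gap_combine)

text \<open>Turns comparisons of rates into comparisons of gaps; since the gap at the optimum is
  \<open>P\<^sub>c\<close>, a rate is located relative to the optimum by testing its gap against
  \<open>P\<^sub>c\<close>.\<close>

lemma gap_variable_power_less_iff:
  assumes "0 \<le> \<kappa>" "0 < s" "0 < t"
  shows "\<kappa> * circuit_gap s + power_gap s < \<kappa> * circuit_gap t + power_gap t \<longleftrightarrow> s < t"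
proof -
  have "\<kappa> * circuit_gap s + power_gap s < \<kappa> * circuit_gap t + power_gap t" if "0 < s" "s < t" for s t
    using gap_strict_mono[OF variable_power_smooth_convex slope_strict_mono that] assms(1)
    by (simp only: gap_variable_power)
  from this[of s t] this[of t s] assms(2,3) show ?thesis
    by (cases s t rule: linorder_cases) auto
qed

lemma optimum_exists:
  assumes "0 \<le> \<kappa>"
  obtains s where "0 < s" "\<kappa> * circuit_gap s + power_gap s = P\<^sub>c"
proof -
  \<comment> \<open>The transmission part alone already reaches \<open>P\<^sub>c\<close>, and the
    nonnegative circuit gap can only add to it.\<close>
  obtain x where x: "0 < x" "P\<^sub>c / (\<alpha>) \<le> gap (min_power C) d x"
    using gap_unbounded[OF power slope_large] by blast
  then have "P\<^sub>c \<le> power_gap x"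
    using \<alpha>(2) by (simp add: pos_divide_le_eq mult.commute)
  also have "\<dots> \<le> gap (variable_power \<kappa>) (slope \<kappa>) x"
    using assms gap_nonneg[OF circuit x(1)] by (simp add: gap_variable_power)
  finally show thesis
    using gap_attains[OF variable_power_smooth_convex[OF assms] x(1) P\<^sub>c] that
    unfolding gap_variable_power by blast
qed

lemma energy_less:
  assumes "0 \<le> \<kappa>" "0 < s" "\<kappa> * circuit_gap s + power_gap s = P\<^sub>c" "0 \<le> t" "t \<noteq> s"
  shows "\<E> \<kappa> s < \<E> \<kappa> t"
proof (cases "t = 0")
  case True
  then show ?thesis using assms by (simp add: energy_per_bit_def)
next
  case False
  then have "0 < t" using assms by simp
  then have "(variable_power \<kappa> s + P\<^sub>c) / s < (variable_power \<kappa> t + P\<^sub>c) / t"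
    using assms by (intro gap_imp_strict_ratio_min[OF variable_power_smooth_convex slope_strict_mono])
      (simp_all only: gap_variable_power not_False_eq_True)
  then have "(variable_power \<kappa> s + P\<^sub>c) / s / B < (variable_power \<kappa> t + P\<^sub>c) / t / B"
    using B by (rule divide_strict_right_mono)
  then show ?thesis
    using False assms(2) by (simp add: energy_per_bit_def total_power_def \<alpha>(1) mult.commute)
qed

lemma opt_rate_eqI:
  assumes "0 \<le> \<kappa>" "0 < s" "\<kappa> * circuit_gap s + power_gap s = P\<^sub>c"
  shows "rate_opt \<kappa> = s"
  unfolding opt_rate_def
proof (rule the_equality)
  show "is_arg_min (\<E> \<kappa>) (\<lambda>s. 0 \<le> s) s"
    using energy_less[OF assms] assms(2) unfolding is_arg_min_def
    by (metis less_imp_le less_asym)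
  show "t = s" if "is_arg_min (\<E> \<kappa>) (\<lambda>s. 0 \<le> s) t" for t
    using energy_less[OF assms, of t] that assms(2) unfolding is_arg_min_def
    by (metis less_imp_le)
qed

lemma opt_rate_props:
  assumes "0 \<le> \<kappa>"
  shows "0 < rate_opt \<kappa>" "\<kappa> * circuit_gap (rate_opt \<kappa>) + power_gap (rate_opt \<kappa>) = P\<^sub>c"
proof -
  obtain s where "0 < s" "\<kappa> * circuit_gap s + power_gap s = P\<^sub>c"
    using optimum_exists[OF assms] .
  moreover from this have "rate_opt \<kappa> = s"
    by (rule opt_rate_eqI[OF assms])
  ultimately show "0 < rate_opt \<kappa>" "\<kappa> * circuit_gap (rate_opt \<kappa>) + power_gap (rate_opt \<kappa>) = P\<^sub>c"
    by simp_all
qed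

lemma opt_energy_eq:
  assumes "0 \<le> \<kappa>"
  shows "opt_energy B \<sigma> \<xi> P\<^sub>c \<phi> C \<kappa> = \<E> \<kappa> (rate_opt \<kappa>)"
  unfolding opt_energy_def
proof (rule Least_equality)
  note props = opt_rate_props[OF assms]
  show "\<E> \<kappa> (rate_opt \<kappa>) \<in> \<E> \<kappa> ` {0..}"
    using props(1) by (intro imageI) auto
  fix y assume "y \<in> \<E> \<kappa> ` {0..}"
  then obtain t where "0 \<le> t" "y = \<E> \<kappa> t" by auto
  then show "\<E> \<kappa> (rate_opt \<kappa>) \<le> y"
    using energy_less[OF assms props, of t] by (cases "t = rate_opt \<kappa>") auto
qed

lemma opt_energy_strict_mono: "strict_mono_on {0..} (opt_energy B \<sigma> \<xi> P\<^sub>c \<phi> C)"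
proof (rule strict_mono_onI)
  fix \<kappa> \<kappa>' :: real assume "\<kappa> \<in> {0..}" "\<kappa>' \<in> {0..}" and less: "\<kappa> < \<kappa>'"
  then have \<kappa>: "0 \<le> \<kappa>" "0 \<le> \<kappa>'" by auto
  \<comment> \<open>Both energies are compared at the optimum of the larger coefficient, where the
    circuit term is positive.\<close>
  define t where "t = rate_opt \<kappa>'"
  have t: "0 < t"
    using opt_rate_props[OF \<kappa>(2)] by (simp add: t_def)
  have "\<E> \<kappa> (rate_opt \<kappa>) \<le> \<E> \<kappa> t"
    using energy_less[OF \<kappa>(1) opt_rate_props[OF \<kappa>(1)], of t] t by (cases "t = rate_opt \<kappa>") auto
  also have "\<dots> < \<E> \<kappa>' t"
    using t less B circuit_pos[OF t]
    by (simp add: energy_per_bit_def total_power_def divide_strict_right_mono)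
  finally show "opt_energy B \<sigma> \<xi> P\<^sub>c \<phi> C \<kappa> < opt_energy B \<sigma> \<xi> P\<^sub>c \<phi> C \<kappa>'"
    using \<kappa> by (simp add: opt_energy_eq t_def)
qed

text \<open>For positive \<open>s\<close> this is the optimality condition with coefficient 0; at
  \<open>s = 0\<close> the left side vanishes whereas \<open>P\<^sub>c\<close> is positive.\<close>

lemma marginal_gap_eq_iff:
  assumes "0 \<le> s"
  shows "\<alpha> * marginal_gap C s = P\<^sub>c \<longleftrightarrow> s = rate_opt 0"
proof (cases "s = 0")
  case True
  then show ?thesis
    using opt_rate_props(1)[of 0] P\<^sub>c smooth_convex_zero[OF power] by (simp add: marginal_gap_def)
next
  case False
  then have s: "0 < s" using assms by simp
  then have "marginal_gap C s = gap (min_power C) d s"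
    using DERIV_imp_deriv[OF smooth_convex_derivative[OF power s]]
    by (simp add: marginal_gap_def gap_def)
  then show ?thesis
    using opt_rate_eqI[of 0 s] opt_rate_props(2)[of 0] s by auto
qed

section \<open>Dependence on the coefficient under strict convexity\<close>

context
  assumes strict: "strictly_convex_on {0..} \<phi>"
begin

lemma circuit_gap_pos: "0 < s \<Longrightarrow> 0 < circuit_gap s"
  using strictly_convex_gap_pos[OF circuit strictly_convex_on_scale[OF strict B]] .

text \<open>A larger coefficient lifts the gap at the old optimum above \<open>P\<^sub>c\<close>, so
  the new optimum lies to its left.\<close>

lemma opt_rate_strict_antimono: "strict_antimono_on {0..} rate_opt"
proof (rule monotone_onI)
  fix \<kappa> \<kappa>' :: real assume "\<kappa> \<in> {0..}" "\<kappa>' \<in> {0..}" and less: "\<kappa> < \<kappa>'"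
  then have \<kappa>: "0 \<le> \<kappa>" "0 \<le> \<kappa>'" by auto
  note p = opt_rate_props[OF \<kappa>(1)] and p' = opt_rate_props[OF \<kappa>(2)]
  have "\<kappa> * circuit_gap (rate_opt \<kappa>) < \<kappa>' * circuit_gap (rate_opt \<kappa>)"
    using less circuit_gap_pos[OF p(1)] by simp
  then show "rate_opt \<kappa>' < rate_opt \<kappa>"
    using p(2) p'(2) gap_variable_power_less_iff[OF \<kappa>(2) p'(1) p(1)] by linarith
qed

lemma opt_rate_tendsto_zero: "(rate_opt \<longlongrightarrow> 0) at_top"
proof (rule order_tendstoI)
  fix a :: real assume "a < 0"
  show "\<forall>\<^sub>F \<kappa> in at_top. a < rate_opt \<kappa>"
    using eventually_ge_at_top[of 0]
  proof eventually_elim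
    case (elim \<kappa>)
    then show ?case
      using opt_rate_props(1)[of \<kappa>] \<open>a < 0\<close> by simp
  qed
next
  fix a :: real assume a: "0 < a"
  \<comment> \<open>From this threshold on, the circuit part of the gap at \<open>a\<close> alone
    exceeds \<open>P\<^sub>c\<close>.\<close>
  have "\<forall>\<^sub>F \<kappa> in at_top. max 0 (P\<^sub>c / circuit_gap a) < \<kappa>" by (rule eventually_gt_at_top)
  then show "\<forall>\<^sub>F \<kappa> in at_top. rate_opt \<kappa> < a"
  proof eventually_elim
    case (elim \<kappa>)
    then have \<kappa>: "0 \<le> \<kappa>" by simp
    note p = opt_rate_props[OF \<kappa>]
    have "P\<^sub>c < \<kappa> * circuit_gap a"
      using elim circuit_gap_pos[OF a] by (simp add: pos_divide_less_eq)
    moreover have "0 \<le> power_gap a"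
      using \<alpha>(2) gap_nonneg[OF power a] by (intro mult_nonneg_nonneg) auto
    ultimately show ?case
      using p gap_variable_power_less_iff[OF \<kappa> p(1) a] by linarith
  qed
qed

lemma opt_rate_tendsto_zero_coefficient: "(rate_opt \<longlongrightarrow> rate_opt 0) (at_right 0)"
proof (rule order_tendstoI)
  fix a assume a: "rate_opt 0 < a"
  show "\<forall>\<^sub>F \<kappa> in at_right 0. rate_opt \<kappa> < a"
    using eventually_at_right_less[of 0]
  proof eventually_elim
    case (elim \<kappa>)
    then show ?case
      using monotone_onD[OF opt_rate_strict_antimono, of 0 \<kappa>] a by simp
  qed
next
  fix a assume a: "a < rate_opt 0"
  \<comment> \<open>A positive test rate between \<open>a\<close> and the limit; \<open>a\<close>
    itself may be negative. Its gap at coefficient 0 is below \<open>P\<^sub>c\<close> and stays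
    below for small \<kappa>.\<close>
  define b where "b = max a (rate_opt 0 / 2)"
  have p0: "0 < rate_opt 0" "power_gap (rate_opt 0) = P\<^sub>c"
    using opt_rate_props[of 0] by auto
  have b: "0 < b" "a \<le> b" "b < rate_opt 0"
    using a p0 by (auto simp: b_def)
  have "power_gap b < P\<^sub>c"
    using gap_variable_power_less_iff[of 0 b "rate_opt 0"] b p0 by simp
  then have "0 < (P\<^sub>c - power_gap b) / circuit_gap b"
    using circuit_gap_pos[OF b(1)] by simp
  then have "\<forall>\<^sub>F \<kappa> in at_right 0. \<kappa> < (P\<^sub>c - power_gap b) / circuit_gap b"
    by (rule order_tendstoD(2)[OF tendsto_ident_at])
  with eventually_at_right_less[of 0] show "\<forall>\<^sub>F \<kappa> in at_right 0. a < rate_opt \<kappa>"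
  proof eventually_elim
    case (elim \<kappa>)
    then have \<kappa>: "0 \<le> \<kappa>" by simp
    note p = opt_rate_props[OF \<kappa>]
    have "\<kappa> * circuit_gap b < P\<^sub>c - power_gap b"
      using elim circuit_gap_pos[OF b(1)] by (simp add: pos_less_divide_eq)
    then have "b < rate_opt \<kappa>"
      using p gap_variable_power_less_iff[OF \<kappa> b(1) p(1)] by linarith
    with b(2) show ?case by simp
  qed
qed

end

text \<open>The circuit gap vanishes, so the optimality condition is the same for every
  coefficient.\<close>

lemma opt_rate_linear:
  assumes "\<And>R. 0 \<le> R \<Longrightarrow> \<phi> R = R" "0 \<le> \<kappa>"
  shows "rate_opt \<kappa> = rate_opt 0"
proof (rule opt_rate_eqI)
  note p = opt_rate_props[of 0]
  show "0 < rate_opt 0" using p by simp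
  have "circuit_gap (rate_opt 0) = 0"
    using assms(1) B p(1) by (intro linear_gap_zero[OF circuit, of B]) auto
  then show "\<kappa> * circuit_gap (rate_opt 0) + power_gap (rate_opt 0) = P\<^sub>c"
    using p by simp
qed fact

end

theorem theorem2:
  fixes B \<sigma> \<xi> P\<^sub>c :: real
    and \<phi> :: "real \<Rightarrow> real"
    and C :: "'a channel"
  assumes "0 < B" and "0 < \<sigma>\<^sup>2" and "0 < \<xi>" and "0 < P\<^sub>c"
    and "\<phi> 0 = 0"
    and "\<phi> differentiable_on {0..}"
    and "strict_mono_on {0..} \<phi>"
    and "convex_on {0..} \<phi>"
    and "valid_channel C"
  shows "strict_mono_on {0..} (opt_energy B \<sigma> \<xi> P\<^sub>c \<phi> C) \<and>
    (\<exists>s\<^sub>1\<ge>0.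
       (\<forall>s\<ge>0. \<sigma>\<^sup>2 / \<xi> * marginal_gap C s = P\<^sub>c \<longleftrightarrow> s = s\<^sub>1) \<and>
       (strictly_convex_on {0..} \<phi> \<longrightarrow>
          strict_antimono_on {0..} (opt_rate B \<sigma> \<xi> P\<^sub>c \<phi> C) \<and>
          (opt_rate B \<sigma> \<xi> P\<^sub>c \<phi> C \<longlongrightarrow> 0) at_top \<and>
          (opt_rate B \<sigma> \<xi> P\<^sub>c \<phi> C \<longlongrightarrow> s\<^sub>1) (at_right 0)) \<and>
       ((\<forall>R\<ge>0. \<phi> R = R) \<longrightarrow> (\<forall>\<kappa>\<ge>0. opt_rate B \<sigma> \<xi> P\<^sub>c \<phi> C \<kappa> = s\<^sub>1)))"
proof -
  have pos: "0 < \<phi> x" if "0 < x" for x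
    using strict_mono_onD[OF assms(7), of 0 x] that assms(5) by simp
  have nonneg: "0 \<le> \<phi> x" if "0 \<le> x" for x
    using pos[of x] that assms(5) by (cases "x = 0") auto
  obtain e where "smooth_convex \<phi> e"
    using convex_differentiable_imp_smooth_convex[OF assms(5) nonneg assms(8,6)] by blast
  then have e: "smooth_convex (\<lambda>s. \<phi> (B * s)) (\<lambda>s. B * e (B * s))"
    using assms(1) by (rule smooth_convex_scale)
  obtain d where d: "smooth_convex (min_power C) d" "strict_mono_on {0<..} d" "\<And>K. \<exists>x>0. K \<le> d x"
    using min_power_smooth_convex[OF assms(9)] by blast
  interpret power_model B \<sigma> \<xi> P\<^sub>c \<phi> C "\<sigma>\<^sup>2 / \<xi>" "\<lambda>s. B * e (B * s)" d
    using assms(1-4) pos e d by unfold_locales simp_all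
  show ?thesis
  \<comment> \<open>The witness is the optimum at coefficient 0, where only the transmission part of
    the gap remains.\<close>
  proof (intro conjI exI[of _ "rate_opt 0"] impI allI)
    show "0 \<le> rate_opt 0"
      using opt_rate_props(1)[of 0] by simp
  qed (use opt_energy_strict_mono marginal_gap_eq_iff opt_rate_strict_antimono opt_rate_tendsto_zero
      opt_rate_tendsto_zero_coefficient opt_rate_linear in blast)+
qed

end
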